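(* Let $\mathcal{H}_1,\mathcal{H}_2,\mathcal{H}_3,\mathcal{H}_4$ be separable Hilbert spaces, $r\in\mathbb{N}$, $M\in L_2(\mathcal{H}_1,\mathcal{H}_4)$, $B\in\mathcal{B}(\mathcal{H}_3,\mathcal{H}_4)$, $C\in\mathcal{B}(\mathcal{H}_1,\mathcal{H}_2)$, and let $\mathcal{X}_r,\mathcal{Y}_r,\mathcal{S}_r,\mathcal{S}_{r,*}$ be the sets defined in the context. The problem $\min\{\|M-BXC\|_{L_2}:X\in\mathcal{X}_r\}$ admits a solution if and only if $\mathcal{Y}_r\neq\emptyset$. In that case, $$\mathcal{S}_r\cap\{\operatorname{dom}(X)=\operatorname{dom}(C^\dagger)\}=\Big\{\hat X+P_{\ker B}T+SP_{(\operatorname{ran}C)^\perp}:\ \hat X\in\mathcal{S}_{r,*},\ T:\operatorname{dom}(C^\dagger)\subset\mathcal{H}_2\to\mathcal{H}_3,\ S:(\operatorname{ran}C)^\perp\subset\mathcal{H}_2\to\mathcal{H}_3\Big\},$$ where $T$ and $S$ range over linear operators with the indicated domains.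
   Context: All Hilbert spaces are over a common field $\mathbb{R}$ or $\mathbb{C}$ and may be finite- or infinite-dimensional. A linear operator $T:\mathcal{H}\to\mathcal{K}$ is a linear map defined on a linear subspace $\operatorname{dom}(T)\subset\mathcal{H}$ (not necessarily all of $\mathcal{H}$), possibly unbounded; $\operatorname{dom}(T+S)=\operatorname{dom}T\cap\operatorname{dom}S$, $\operatorname{dom}(TS)=S^{-1}(\operatorname{dom}T)$. $\mathcal{B}(\mathcal{H},\mathcal{K})$ denotes the bounded everywhere-defined operators, $L_2(\mathcal{H},\mathcal{K})$ the Hilbert--Schmidt operators with norm $\|\cdot\|_{L_2}$, and $\mathcal{B}_{00,r}(\mathcal{H},\mathcal{K})$ the bounded operators with range of dimension at most $r$. $P_V$ is the orthogonal projector onto a closed subspace $V$. Moore--Penrose inverse: for $T\in\mathcal{B}(\mathcal{H},\mathcal{K})$, $\operatorname{dom}(T^\dagger)=\operatorname{ran}T\oplus(\operatorname{ran}T)^\perp$ and $T^\dagger(h+k)=(T|_{(\ker T)^\perp})^{-1}h$ for $h\in\operatorname{ran}T$, $k\in(\operatorname{ran}T)^\perp$. With $K=P_{\overline{\operatorname{ran} B}}MP_{(\ker C)^\perp}$ define $$\mathcal{X}_r=\{X:\mathcal{H}_2\to\mathcal{H}_3 \text{ linear}:\ \operatorname{dom}(X)\supset\operatorname{dom}(C^\dagger),\ \dim\operatorname{ran}X\le r,\ BXC\in L_2(\mathcal{H}_1,\mathcal{H}_4)\},$$ $$\mathcal{Y}_r=\{Y\in\mathcal{B}_{00,r}(\mathcal{H}_1,\mathcal{H}_4):\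 \operatorname{ran}Y\subset\operatorname{dom}(B^\dagger),\ \|K-Y\|_{L_2}\le\|K-\tilde Y\|_{L_2}\ \forall\,\tilde Y\in\mathcal{B}_{00,r}(\mathcal{H}_1,\mathcal{H}_4)\},$$ $$\mathcal{S}_r=\{X\in\mathcal{X}_r:\ \|M-BXC\|_{L_2}\le\|M-B\tilde XC\|_{L_2}\ \forall\tilde X\in\mathcal{X}_r\},$$ $$\mathcal{S}_{r,*}=\{X\in\mathcal{S}_r:\ X=P_{(\ker B)^\perp}XP_{\overline{\operatorname{ran}C}}\text{ on }\operatorname{dom}(X)\}.$$
   Formalization: The set on the right-hand side is restricted to those sums X̂ + P_{ker B}T + SP_{(ran C)^⊥} whose range has dimension at most r; without this the identity fails (e.g. M = B = C = 0 on ℝ², r = 1, X̂ = 0, T = identity, S = 0). *)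

theory Defs
  imports "HOL-Analysis.Analysis"
begin

section \<open>The scalar field\<close>

text \<open>
  Distinguished embedding into the complex numbers, with image all of \<open>\<real>\<close> or all of \<open>\<complex>\<close>:
  up to isomorphism the instances are exactly the real and the complex field.
\<close>

class real_or_complex = real_normed_field +
  fixes to_complex :: "'a \<Rightarrow> complex"
  assumes to_complex_add: "to_complex (x + y) = to_complex x + to_complex y"
    and to_complex_mult: "to_complex (x * y) = to_complex x * to_complex y"
    and to_complex_scaleR: "to_complex (t *\<^sub>R x) = t *\<^sub>R to_complex x"
    and norm_to_complex: "norm (to_complex x) = norm x"
    and range_to_complex: "range to_complex = \<real> \<or> range to_complex = UNIV"

instantiation real :: real_or_complex
begin
definition to_complex_real :: "real \<Rightarrow> complex" where "to_complex_real = complex_of_real"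
instance
  by standard (auto simp: to_complex_real_def scaleR_conv_of_real Reals_def)
end

instantiation complex :: real_or_complex
begin
definition to_complex_complex :: "complex \<Rightarrow> complex" where "to_complex_complex = id"
instance
  by standard (auto simp: to_complex_complex_def)
end

section \<open>Hilbert spaces\<close>

text \<open>
  The underlying Banach space comes from the type; the record adds multiplication by
  \<open>'k\<close>-scalars and the \<open>'k\<close>-valued inner product, linear in its first argument.
\<close>

record ('k, 'a) hspace =
  hscale :: "'k \<Rightarrow> 'a \<Rightarrow> 'a"
  hinner :: "'a \<Rightarrow> 'a \<Rightarrow> 'k"

locale hilbert_space = vector_space "hscale H"
  for H :: "('k::real_or_complex, 'a::banach) hspace" +
  assumes hscale_of_real: "hscale H (of_real t) x = t *\<^sub>R x"
    and hinner_add_left: "hinner H (x + y) z = hinner H x z + hinner H y z"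
    and hinner_hscale_left: "hinner H (hscale H c x) y = c * hinner H x y"
    and hinner_commute: "to_complex (hinner H x y) = cnj (to_complex (hinner H y x))"
    and hinner_self: "hinner H x x = of_real ((norm x)\<^sup>2)"

abbreviation hsubspace :: "('k::real_or_complex, 'a::banach) hspace \<Rightarrow> 'a set \<Rightarrow> bool" where
  "hsubspace H \<equiv> module.subspace (hscale H)"

abbreviation hspan :: "('k::real_or_complex, 'a::banach) hspace \<Rightarrow> 'a set \<Rightarrow> 'a set" where
  "hspan H \<equiv> module.span (hscale H)"

definition orth :: "('k::real_or_complex, 'a::banach) hspace \<Rightarrow> 'a set \<Rightarrow> 'a set" where
  "orth H V = {x. \<forall>v\<in>V. hinner H x v = 0}"

text \<open>
  The first conjunct is not redundant: \<^const>\<open>vector_space.dim\<close> is \<open>0\<close> on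
  infinite-dimensional subspaces.
\<close>

definition dim_at_most :: "('k::real_or_complex, 'a::banach) hspace \<Rightarrow> 'a set \<Rightarrow> nat \<Rightarrow> bool" where
  "dim_at_most H V r \<longleftrightarrow> (\<exists>F. finite F \<and> hspan H F = V) \<and> vector_space.dim (hscale H) V \<le> r"

definition is_onb :: "('k::real_or_complex, 'a::banach) hspace \<Rightarrow> 'a set \<Rightarrow> bool" where
  "is_onb H E \<longleftrightarrow>
     (\<forall>e\<in>E. \<forall>f\<in>E. hinner H e f = (if e = f then 1 else 0)) \<and> closure (hspan H E) = UNIV"

definition onb :: "('k::real_or_complex, 'a::banach) hspace \<Rightarrow> 'a set" where
  "onb H = (SOME E. is_onb H E)"

section \<open>Linear operators\<close>

text \<open>
  A possibly unbounded operator is a partial function, so that equality of operators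
  includes equality of domains.  Products are \<^const>\<open>map_comp\<close>, with
  \<open>dom (T \<circ>\<^sub>m S) = {x \<in> dom S. the (S x) \<in> dom T}\<close>, and ranges are \<^const>\<open>ran\<close>.
\<close>

definition lin_op ::
  "('k::real_or_complex, 'a::banach) hspace \<Rightarrow> ('k, 'b::banach) hspace \<Rightarrow> ('a \<rightharpoonup> 'b) \<Rightarrow> bool" where
  "lin_op H K T \<longleftrightarrow> hsubspace H (dom T) \<and>
     (\<forall>x\<in>dom T. \<forall>y\<in>dom T. the (T (x + y)) = the (T x) + the (T y)) \<and>
     (\<forall>c. \<forall>x\<in>dom T. the (T (hscale H c x)) = hscale K c (the (T x)))"

definition op_add :: "('a \<rightharpoonup> 'b::plus) \<Rightarrow> ('a \<rightharpoonup> 'b) \<Rightarrow> ('a \<rightharpoonup> 'b)" (infixl \<open>+\<^sub>p\<close> 65) where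
  "T +\<^sub>p S = (\<lambda>x. if x \<in> dom T \<inter> dom S then Some (the (T x) + the (S x)) else None)"

definition op_diff :: "('a \<rightharpoonup> 'b::minus) \<Rightarrow> ('a \<rightharpoonup> 'b) \<Rightarrow> ('a \<rightharpoonup> 'b)" (infixl \<open>-\<^sub>p\<close> 65) where
  "T -\<^sub>p S = (\<lambda>x. if x \<in> dom T \<inter> dom S then Some (the (T x) - the (S x)) else None)"

definition ker :: "('a \<rightharpoonup> 'b::zero) \<Rightarrow> 'a set" where
  "ker T = {x. T x = Some 0}"

definition bounded_ops ::
  "('k::real_or_complex, 'a::banach) hspace \<Rightarrow> ('k, 'b::banach) hspace \<Rightarrow> ('a \<rightharpoonup> 'b) set" where
  "bounded_ops H K =
     {T. lin_op H K T \<and> dom T = UNIV \<and> (\<exists>c. \<forall>x. norm (the (T x)) \<le> c * norm x)}"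

definition finite_rank_ops ::
  "nat \<Rightarrow> ('k::real_or_complex, 'a::banach) hspace \<Rightarrow> ('k, 'b::banach) hspace \<Rightarrow> ('a \<rightharpoonup> 'b) set"
  where
  "finite_rank_ops r H K = {T \<in> bounded_ops H K. dim_at_most K (ran T) r}"

text \<open>Neither the Hilbert--Schmidt property nor the norm depends on the orthonormal basis.\<close>

definition hs_ops ::
  "('k::real_or_complex, 'a::banach) hspace \<Rightarrow> ('k, 'b::banach) hspace \<Rightarrow> ('a \<rightharpoonup> 'b) set" where
  "hs_ops H K = {T \<in> bounded_ops H K. (\<lambda>e. (norm (the (T e)))\<^sup>2) summable_on onb H}"

definition hs_norm ::
  "('k::real_or_complex, 'a::banach) hspace \<Rightarrow> ('a \<rightharpoonup> 'b::banach) \<Rightarrow> real" where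
  "hs_norm H T = sqrt (\<Sum>\<^sub>\<infinity>e\<in>onb H. (norm (the (T e)))\<^sup>2)"

text \<open>Orthogonal projector; meaningful for closed subspaces only.\<close>

definition proj :: "('k::real_or_complex, 'a::banach) hspace \<Rightarrow> 'a set \<Rightarrow> ('a \<rightharpoonup> 'a)" where
  "proj H V = (\<lambda>x. Some (THE y. y \<in> V \<and> x - y \<in> orth H V))"

definition mp_inverse ::
  "('k::real_or_complex, 'a::banach) hspace \<Rightarrow> ('k, 'b::banach) hspace \<Rightarrow> ('a \<rightharpoonup> 'b) \<Rightarrow> ('b \<rightharpoonup> 'a)"
  where
  "mp_inverse H K T = (\<lambda>y.
     if \<exists>h\<in>ran T. \<exists>k\<in>orth K (ran T). y = h + k
     then Some (the_inv_into (orth H (ker T)) (\<lambda>x. the (T x))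
                  (THE h. h \<in> ran T \<and> y - h \<in> orth K (ran T)))
     else None)"

section \<open>The rank-constrained approximation problem\<close>

definition X_set ::
  "('k::real_or_complex, 'a::banach) hspace \<Rightarrow> ('k, 'b::banach) hspace \<Rightarrow>
   ('k, 'c::banach) hspace \<Rightarrow> ('k, 'd::banach) hspace \<Rightarrow>
   ('c \<rightharpoonup> 'd) \<Rightarrow> ('a \<rightharpoonup> 'b) \<Rightarrow> nat \<Rightarrow> ('b \<rightharpoonup> 'c) set" where
  "X_set H1 H2 H3 H4 B C r =
     {X. lin_op H2 H3 X \<and> dom (mp_inverse H1 H2 C) \<subseteq> dom X \<and> dim_at_most H3 (ran X) r \<and>
         B \<circ>\<^sub>m X \<circ>\<^sub>m C \<in> hs_ops H1 H4}"

definition K_op ::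
  "('k::real_or_complex, 'a::banach) hspace \<Rightarrow> ('k, 'd::banach) hspace \<Rightarrow>
   ('a \<rightharpoonup> 'd) \<Rightarrow> ('c \<rightharpoonup> 'd) \<Rightarrow> ('a \<rightharpoonup> 'b::banach) \<Rightarrow> ('a \<rightharpoonup> 'd)" where
  "K_op H1 H4 M B C = proj H4 (closure (ran B)) \<circ>\<^sub>m M \<circ>\<^sub>m proj H1 (orth H1 (ker C))"

definition Y_set ::
  "('k::real_or_complex, 'a::banach) hspace \<Rightarrow>
   ('k, 'c::banach) hspace \<Rightarrow> ('k, 'd::banach) hspace \<Rightarrow>
   ('a \<rightharpoonup> 'd) \<Rightarrow> ('c \<rightharpoonup> 'd) \<Rightarrow> ('a \<rightharpoonup> 'b::banach) \<Rightarrow> nat \<Rightarrow> ('a \<rightharpoonup> 'd) set" where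
  "Y_set H1 H3 H4 M B C r =
     {Y \<in> finite_rank_ops r H1 H4. ran Y \<subseteq> dom (mp_inverse H3 H4 B) \<and>
        (\<forall>Y'\<in>finite_rank_ops r H1 H4.
           hs_norm H1 (K_op H1 H4 M B C -\<^sub>p Y) \<le> hs_norm H1 (K_op H1 H4 M B C -\<^sub>p Y'))}"

definition S_set ::
  "('k::real_or_complex, 'a::banach) hspace \<Rightarrow> ('k, 'b::banach) hspace \<Rightarrow>
   ('k, 'c::banach) hspace \<Rightarrow> ('k, 'd::banach) hspace \<Rightarrow>
   ('a \<rightharpoonup> 'd) \<Rightarrow> ('c \<rightharpoonup> 'd) \<Rightarrow> ('a \<rightharpoonup> 'b) \<Rightarrow> nat \<Rightarrow> ('b \<rightharpoonup> 'c) set" where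
  "S_set H1 H2 H3 H4 M B C r =
     {X \<in> X_set H1 H2 H3 H4 B C r. \<forall>X'\<in>X_set H1 H2 H3 H4 B C r.
        hs_norm H1 (M -\<^sub>p (B \<circ>\<^sub>m X \<circ>\<^sub>m C)) \<le> hs_norm H1 (M -\<^sub>p (B \<circ>\<^sub>m X' \<circ>\<^sub>m C))}"

definition S_star_set ::
  "('k::real_or_complex, 'a::banach) hspace \<Rightarrow> ('k, 'b::banach) hspace \<Rightarrow>
   ('k, 'c::banach) hspace \<Rightarrow> ('k, 'd::banach) hspace \<Rightarrow>
   ('a \<rightharpoonup> 'd) \<Rightarrow> ('c \<rightharpoonup> 'd) \<Rightarrow> ('a \<rightharpoonup> 'b) \<Rightarrow> nat \<Rightarrow> ('b \<rightharpoonup> 'c) set" where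
  "S_star_set H1 H2 H3 H4 M B C r =
     {X \<in> S_set H1 H2 H3 H4 M B C r. \<forall>x\<in>dom X.
        X x = (proj H3 (orth H3 (ker B)) \<circ>\<^sub>m X \<circ>\<^sub>m proj H2 (closure (ran C))) x}"

text \<open>
  Membership in \<^const>\<open>X_set\<close> bounds the rank by \<open>r\<close>.  A sum
  \<open>X + P\<^bsub>ker B\<^esub> T + S P\<^bsub>(ran C)\<^sup>\<bottom>\<^esub>\<close> with arbitrary linear \<open>T\<close>, \<open>S\<close> may violate this bound
  (take \<open>M = B = C = 0\<close>), so a description of the solutions by such sums has to be
  restricted to those sums that have rank at most \<open>r\<close>.
\<close>

end

theory Submission
  imports Defs
begin

text \<open>
  Every \<open>B X C\<close> is fixed by the compression \<open>T \<mapsto> P T Q\<close>, where \<open>P\<close> projects onto the closure of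
  \<open>ran B\<close> and \<open>Q\<close> onto the orthogonal complement of \<open>ker C\<close>.  Pythagoras in \<open>L\<^sub>2\<close> therefore gives
  \<open>\<parallel>M - B X C\<parallel>\<^sup>2 = \<parallel>M - K\<parallel>\<^sup>2 + \<parallel>K - B X C\<parallel>\<^sup>2\<close>, and since operators \<open>B X C\<close> of rank at most
  \<open>r\<close> approximate every compressed operator of rank at most \<open>r\<close>, minimising over \<open>X\<close> amounts to a best
  rank-\<open>r\<close> approximation of \<open>K\<close>: a solution \<open>X\<close> yields \<open>Y = B X C\<close>, and conversely an optimal \<open>Y\<close>
  equals \<open>P Y Q\<close>, so that \<open>X = B\<^sup>\<dagger> Y C\<^sup>\<dagger>\<close> satisfies \<open>B X C = Y\<close>.  The objective only sees \<open>B X C\<close>,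
  which depends on neither the component of \<open>X\<close> in \<open>ker B\<close> nor the restriction of \<open>X\<close> to the
  orthogonal complement of \<open>ran C\<close>.
\<close>

section \<open>Inner products and orthogonal projections\<close>

text \<open>Neither ran B nor ran C need be closed, so the operators B X C of rank at most r need
  not exhaust the compressed operators of that rank; they only approximate them. Infima therefore
  agree while attainment may fail, and the range condition in \<open>Y_set\<close> decides it: the
  values of an optimal Y lie in the closure of ran B, and membership in the domain of the
  Moore-Penrose inverse of B forces them into ran B itself. On the side of C it suffices that Y
  vanishes on ker C and so factors through ran C; the price is that X may be unbounded and defined
  only on the domain of the Moore-Penrose inverse of C. No singular value decomposition enters: the
  existence of a best approximation of K is never asserted, optima are only compared with explicit
  competitors. Adjoints serve two purposes: they reduce precomposition with a projector to
  Pythagoras in the target of the adjoint, and they identify the orthogonal complement of ker C with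
  the closure of the range of the adjoint of C, which supplies the approximating vectors on the
  input side.\<close>

lemma to_complex_0 [simp]: "to_complex (0::'k::real_or_complex) = 0"
  using to_complex_add[of "0::'k" 0] by simp

lemma to_complex_minus: "to_complex (- x::'k::real_or_complex) = - to_complex x"
  using to_complex_add[of x "- x"] by (simp add: eq_neg_iff_add_eq_0 add.commute)

lemma to_complex_diff: "to_complex (x - y::'k::real_or_complex) = to_complex x - to_complex y"
  using to_complex_add[of x "- y"] by (simp add: to_complex_minus)

lemma to_complex_inject [simp]: "to_complex (x::'k::real_or_complex) = to_complex y \<longleftrightarrow> x = y"
proof
  assume "to_complex x = to_complex y"
  then have "norm (x - y) = 0"
    using norm_to_complex[of "x - y"] by (simp add: to_complex_diff)
  then show "x = y" by simp
qed simp

lemma to_complex_eqI: "to_complex (x::'k::real_or_complex) = to_complex y \<Longrightarrow> x = y"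
  by simp

lemma to_complex_1 [simp]: "to_complex (1::'k::real_or_complex) = 1"
proof -
  have "to_complex (1::'k) * to_complex (1::'k) = to_complex (1::'k)"
    by (metis mult_1 to_complex_mult)
  moreover have "to_complex (1::'k) \<noteq> 0"
    using norm_to_complex[of "1::'k"] by auto
  ultimately show ?thesis by simp
qed

lemma to_complex_of_real [simp]: "to_complex (of_real t::'k::real_or_complex) = of_real t"
  using to_complex_scaleR[of t "1::'k"] by (simp add: of_real_def)

text \<open>Conjugation pulled back from the complex numbers. Using \<open>inv\<close> is sound
  because \<open>to_complex\<close> is injective and its image, all reals or all complex numbers, is
  closed under \<open>cnj\<close>.\<close>

definition kconj :: "'k::real_or_complex \<Rightarrow> 'k" where
  "kconj x = inv to_complex (cnj (to_complex x))"

lemma to_complex_kconj [simp]: "to_complex (kconj (x::'k::real_or_complex)) = cnj (to_complex x)"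
proof -
  have "cnj (to_complex x) \<in> range (to_complex :: 'k \<Rightarrow> complex)"
  proof (cases "range (to_complex :: 'k \<Rightarrow> complex) = \<real>")
    case True
    then have "to_complex x \<in> \<real>" by (metis rangeI)
    then have "cnj (to_complex x) = to_complex x" by (simp add: Reals_cnj_iff)
    then show ?thesis by simp
  next
    case False
    then show ?thesis using range_to_complex[where 'a='k] by auto
  qed
  then show ?thesis by (simp add: kconj_def f_inv_into_f)
qed

lemma kconj_kconj [simp]: "kconj (kconj x) = (x::'k::real_or_complex)"
  by (rule to_complex_eqI) simp

lemma kconj_add: "kconj (x + y) = kconj x + kconj (y::'k::real_or_complex)"
  by (rule to_complex_eqI) (simp add: to_complex_add)

lemma kconj_mult: "kconj (x * y) = kconj x * kconj (y::'k::real_or_complex)"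
  by (rule to_complex_eqI) (simp add: to_complex_mult)

lemma kconj_of_real [simp]: "kconj (of_real t::'k::real_or_complex) = of_real t"
  by (rule to_complex_eqI) simp

lemma kconj_0 [simp]: "kconj (0::'k::real_or_complex) = 0"
  by (rule to_complex_eqI) simp

lemma norm_kconj [simp]: "norm (kconj (x::'k::real_or_complex)) = norm x"
  by (metis complex_mod_cnj norm_to_complex to_complex_kconj)

lemma kconj_eq_0_iff [simp]: "kconj (x::'k::real_or_complex) = 0 \<longleftrightarrow> x = 0"
  by (metis norm_kconj norm_eq_zero)

lemma kconj_mult_self: "x * kconj x = of_real ((norm (x::'k::real_or_complex))\<^sup>2)"
proof (rule to_complex_eqI)
  have "to_complex (x * kconj x) = of_real ((cmod (to_complex x))\<^sup>2)"
    unfolding complex_norm_square by (simp add: to_complex_mult)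
  then show "to_complex (x * kconj x) = to_complex (of_real ((norm x)\<^sup>2))"
    unfolding norm_to_complex to_complex_of_real .
qed

section \<open>Algebra of the inner product, Cauchy-Schwarz and continuity\<close>

context hilbert_space
begin

lemma hinner_kconj: "hinner H x y = kconj (hinner H y x)"
  by (rule to_complex_eqI) (simp add: hinner_commute[of x y])

lemma hinner_add_right: "hinner H x (y + z) = hinner H x y + hinner H x z"
  using hinner_kconj hinner_add_left kconj_add by metis

lemma hinner_hscale_right: "hinner H x (hscale H c y) = kconj c * hinner H x y"
  using hinner_kconj hinner_hscale_left kconj_mult by metis

lemma hinner_zero_left [simp]: "hinner H 0 x = 0"
  using hinner_add_left[of 0 0 x] by simp

lemma hinner_zero_right [simp]: "hinner H x 0 = 0"
  using hinner_add_right[of x 0 0] by simp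

lemma hinner_minus_left: "hinner H (- x) y = - hinner H x y"
  using hinner_add_left[of x "- x" y] by (simp add: eq_neg_iff_add_eq_0 add.commute)

lemma hinner_minus_right: "hinner H y (- x) = - hinner H y x"
  using hinner_add_right[of y x "- x"] by (simp add: eq_neg_iff_add_eq_0 add.commute)

lemma hinner_diff_left: "hinner H (x - z) y = hinner H x y - hinner H z y"
  using hinner_add_left[of x "- z" y] by (simp add: hinner_minus_left)

lemma hinner_diff_right: "hinner H y (x - z) = hinner H y x - hinner H y z"
  using hinner_add_right[of y x "- z"] by (simp add: hinner_minus_right)

lemma hinner_sum_left: "hinner H (sum f A) y = (\<Sum>i\<in>A. hinner H (f i) y)"
  by (induction A rule: infinite_finite_induct) (auto simp: hinner_add_left)

lemma hinner_eq_0_commute: "hinner H x y = 0 \<longleftrightarrow> hinner H y x = 0"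
  by (metis hinner_kconj kconj_0)

lemma norm_hinner_commute: "norm (hinner H x y) = norm (hinner H y x)"
  by (metis hinner_kconj norm_kconj)

lemma hinner_self_eq_0 [simp]: "hinner H x x = 0 \<longleftrightarrow> x = 0"
  by (simp add: hinner_self)

lemma norm_add_sq:
  "(norm (x + y))\<^sup>2 = (norm x)\<^sup>2 + (norm y)\<^sup>2 + 2 * Re (to_complex (hinner H x y))"
proof -
  have "hinner H (x + y) (x + y) = hinner H x x + hinner H y y + hinner H x y + hinner H y x"
    by (simp only: hinner_add_left hinner_add_right ac_simps)
  then have "to_complex (hinner H (x + y) (x + y)) = to_complex (hinner H x x)
      + to_complex (hinner H y y) + to_complex (hinner H x y) + cnj (to_complex (hinner H x y))"
    by (simp only: to_complex_add hinner_commute[of y x])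
  then have "complex_of_real ((norm (x + y))\<^sup>2) = of_real ((norm x)\<^sup>2) + of_real ((norm y)\<^sup>2)
      + to_complex (hinner H x y) + cnj (to_complex (hinner H x y))"
    by (simp only: hinner_self to_complex_of_real)
  from arg_cong[OF this, of Re] show ?thesis by simp
qed

lemma pythagoras: "hinner H x y = 0 \<Longrightarrow> (norm (x + y))\<^sup>2 = (norm x)\<^sup>2 + (norm y)\<^sup>2"
  by (simp add: norm_add_sq)

lemma parallelogram:
  fixes x y :: 'a
  shows "(norm (x + y))\<^sup>2 + (norm (x - y))\<^sup>2 = 2 * (norm x)\<^sup>2 + 2 * (norm y)\<^sup>2"
  using norm_add_sq[of x y] norm_add_sq[of x "- y"]
  by (simp add: hinner_minus_right to_complex_minus)

lemma norm_hscale: "norm (hscale H c x) = norm c * norm x"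
proof -
  have "hinner H (hscale H c x) (hscale H c x) = (c * kconj c) * hinner H x x"
    by (simp only: hinner_hscale_left hinner_hscale_right ac_simps)
  then have "(of_real ((norm (hscale H c x))\<^sup>2) :: 'k) = of_real ((norm c * norm x)\<^sup>2)"
    by (simp only: hinner_self kconj_mult_self of_real_mult power_mult_distrib)
  then have "(norm (hscale H c x))\<^sup>2 = (norm c * norm x)\<^sup>2"
    unfolding of_real_eq_iff .
  then show ?thesis by (simp add: power2_eq_iff_nonneg)
qed

text \<open>Removing the component along a single vector, by Pythagoras. The exact loss in the
  squared norm gives both Cauchy-Schwarz and the orthogonality of the nearest-point
  residual.\<close>

lemma norm_diff_component:
  fixes w z :: 'a
  assumes "w \<noteq> 0"
  defines "p \<equiv> hscale H (hinner H z w / of_real ((norm w)\<^sup>2)) w"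
  shows "hinner H (z - p) w = 0"
    and "(norm (z - p))\<^sup>2 = (norm z)\<^sup>2 - (norm (hinner H z w))\<^sup>2 / (norm w)\<^sup>2"
proof -
  show 0: "hinner H (z - p) w = 0"
    using assms by (simp add: hinner_diff_left hinner_hscale_left hinner_self)
  then have "hinner H (z - p) p = 0"
    by (simp add: p_def hinner_hscale_right)
  then have "(norm z)\<^sup>2 = (norm (z - p))\<^sup>2 + (norm p)\<^sup>2"
    using pythagoras by fastforce
  moreover have "(norm p)\<^sup>2 = (norm (hinner H z w))\<^sup>2 / (norm w)\<^sup>2"
    using assms(1)
    by (simp add: p_def norm_hscale norm_divide norm_mult power_divide power_mult_distrib
        field_simps power2_eq_square)
  ultimately show "(norm (z - p))\<^sup>2 = (norm z)\<^sup>2 - (norm (hinner H z w))\<^sup>2 / (norm w)\<^sup>2"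
    by simp
qed

lemma norm_hinner_le: "norm (hinner H x y) \<le> norm x * norm y"
proof (cases "y = 0")
  case False
  have "0 \<le> (norm x)\<^sup>2 - (norm (hinner H x y))\<^sup>2 / (norm y)\<^sup>2"
    using norm_diff_component(2)[OF False, of x] by (metis zero_le_power2)
  then have "(norm (hinner H x y))\<^sup>2 \<le> (norm x * norm y)\<^sup>2"
    using False by (simp add: field_simps power_mult_distrib)
  then show ?thesis by (rule power2_le_imp_le) simp
qed simp

lemma bounded_linear_hinner_left: "bounded_linear (\<lambda>x. hinner H x y)"
proof (rule bounded_linear_intro)
  show "hinner H (t *\<^sub>R x) y = t *\<^sub>R hinner H x y" for t x
    using hinner_hscale_left[of "of_real t" x y] by (simp add: hscale_of_real scaleR_conv_of_real)
qed (use norm_hinner_le in \<open>auto simp: hinner_add_left\<close>)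

lemma bounded_linear_hinner_right: "bounded_linear (\<lambda>x. hinner H y x)"
proof (rule bounded_linear_intro)
  show "hinner H y (t *\<^sub>R x) = t *\<^sub>R hinner H y x" for t x
    using hinner_hscale_right[of y "of_real t" x] by (simp add: hscale_of_real scaleR_conv_of_real)
  show "norm (hinner H y x) \<le> norm x * norm y" for x
    using norm_hinner_le[of y x] by (simp add: mult.commute)
qed (auto simp: hinner_add_right)

lemma bounded_linear_hscale: "bounded_linear (hscale H c)"
proof (rule bounded_linear_intro)
  show "hscale H c (t *\<^sub>R x) = t *\<^sub>R hscale H c x" for t x
    by (simp flip: hscale_of_real add: mult.commute)
  show "norm (hscale H c x) \<le> norm x * norm c" for x
    by (simp add: norm_hscale)
qed (simp add: scale_right_distrib)

lemma hinner_ext: "(\<And>x. hinner H x u = hinner H x v) \<Longrightarrow> u = v"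
  by (metis diff_self hinner_diff_right hinner_self_eq_0 right_minus_eq)

section \<open>Orthogonal complements, projections and Riesz representation\<close>

lemma orthD: "x \<in> orth H V \<Longrightarrow> v \<in> V \<Longrightarrow> hinner H x v = 0"
  by (simp add: orth_def)

lemma subspace_orth: "subspace (orth H V)"
  by (auto simp: subspace_def orth_def hinner_add_left hinner_hscale_left)

lemma closed_orth: "closed (orth H V)"
proof -
  have "closed {x. hinner H x v = 0}" for v
    by (intro closed_Collect_eq linear_continuous_on bounded_linear_hinner_left continuous_on_const)
  then have "closed (\<Inter>v\<in>V. {x. hinner H x v = 0})" by blast
  moreover have "orth H V = (\<Inter>v\<in>V. {x. hinner H x v = 0})" by (auto simp: orth_def)
  ultimately show ?thesis by simp
qed

lemma orth_closure [simp]: "orth H (closure V) = orth H V"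
proof
  show "orth H (closure V) \<subseteq> orth H V"
    using closure_subset by (auto simp: orth_def)
  show "orth H V \<subseteq> orth H (closure V)"
  proof
    fix x assume x: "x \<in> orth H V"
    have "closed {v. hinner H x v = 0}"
      by (intro closed_Collect_eq linear_continuous_on bounded_linear_hinner_right
          continuous_on_const)
    then have "closure V \<subseteq> {v. hinner H x v = 0}"
      using x by (intro closure_minimal) (auto simp: orth_def)
    then show "x \<in> orth H (closure V)" by (auto simp: orth_def)
  qed
qed

lemma orth_antimono: "V \<subseteq> W \<Longrightarrow> orth H W \<subseteq> orth H V"
  by (auto simp: orth_def)

lemma orth_int: "x \<in> V \<Longrightarrow> x \<in> orth H V \<Longrightarrow> x = 0"
  using orthD hinner_self_eq_0 by blast

lemma orth_span: "orth H (span V) = orth H V"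
proof
  show "orth H (span V) \<subseteq> orth H V"
    by (simp add: orth_antimono span_superset)
  show "orth H V \<subseteq> orth H (span V)"
  proof
    fix x assume x: "x \<in> orth H V"
    have "subspace {v. hinner H x v = 0}"
      by (auto simp: subspace_def hinner_add_right hinner_hscale_right)
    then have "span V \<subseteq> {v. hinner H x v = 0}"
      using x by (intro span_minimal) (auto simp: orth_def)
    then show "x \<in> orth H (span V)" by (auto simp: orth_def)
  qed
qed

lemma subspace_closure:
  assumes "subspace V" shows "subspace (closure V)"
  unfolding subspace_def
proof (intro conjI ballI allI)
  show "0 \<in> closure V" using assms subspace_0 closure_subset by blast
  fix x y assume "x \<in> closure V" "y \<in> closure V"
  then obtain f g where "\<And>n::nat. f n \<in> V" "f \<longlonglongrightarrow> x" "\<And>n::nat. g n \<in> V" "g \<longlonglongrightarrow> y"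
    unfolding closure_sequential by blast
  then have "\<And>n. f n + g n \<in> V" "(\<lambda>n. f n + g n) \<longlonglongrightarrow> x + y"
    by (auto intro: tendsto_add subspace_add assms)
  then show "x + y \<in> closure V" unfolding closure_sequential
    by (intro exI[of _ "\<lambda>n. f n + g n"]) auto
next
  fix c x assume "x \<in> closure V"
  then obtain f where "\<And>n::nat. f n \<in> V" "f \<longlonglongrightarrow> x"
    unfolding closure_sequential by blast
  then have "\<And>n. hscale H c (f n) \<in> V" "(\<lambda>n. hscale H c (f n)) \<longlonglongrightarrow> hscale H c x"
    by (auto intro: subspace_scale assms bounded_linear.tendsto[OF bounded_linear_hscale])
  then show "hscale H c x \<in> closure V" unfolding closure_sequential
    by (intro exI[of _ "\<lambda>n. hscale H c (f n)"]) auto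
qed

text \<open>The classical nearest-point argument: a minimising sequence is Cauchy by the
  parallelogram law, its limit stays in the closed subspace, and minimality forces the residual to
  be orthogonal. Uniqueness holds since a subspace meets its complement only in 0.\<close>

theorem orth_decomposition:
  assumes V: "subspace V" "closed V"
  shows "\<exists>!y. y \<in> V \<and> x - y \<in> orth H V"
proof -
  define D where "D = (\<lambda>v. norm (x - v)) ` V"
  define d where "d = Inf D"
  have D: "D \<noteq> {}" "bdd_below D"
    using subspace_0[OF V(1)] by (auto simp: D_def bdd_below_def intro: exI[of _ 0])
  have d_le: "d \<le> norm (x - v)" if "v \<in> V" for v
    unfolding d_def using that D by (auto intro: cInf_lower simp: D_def)
  have d0: "0 \<le> d" unfolding d_def using D(1) by (intro cInf_greatest) (auto simp: D_def)
  have "\<exists>v\<in>V. norm (x - v) < d + 1 / Suc n" for n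
    using cInf_lessD[OF D(1), of "d + 1 / Suc n"] by (auto simp: D_def d_def)
  then obtain v where v: "\<And>n. v n \<in> V" "\<And>n. norm (x - v n) < d + 1 / Suc n"
    by metis
  \<comment> \<open>The midpoint of \<open>v m\<close> and \<open>v n\<close> lies in
    \<open>V\<close>, so the two residuals sum to a vector of norm at least \<open>2 * d\<close>.
    With \<epsilon> = 1/(N+1) the parallelogram law leaves 4 (d + \<epsilon>)^2 - 4 d^2 = 8 d
    \<epsilon> + 4 \<epsilon>^2, and \<epsilon>^2 \<le> \<epsilon> gives the stated
    constant.\<close>
  have bound: "(norm (v m - v n))\<^sup>2 \<le> 4 * (2 * d + 1) / Suc N" if mn: "N \<le> m" "N \<le> n" for m n N
  proof -
    have v_le: "norm (x - v k) \<le> d + 1 / Suc N" if "N \<le> k" for k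
    proof -
      have "1 / Suc k \<le> 1 / real (Suc N)" using that by (simp add: frac_le)
      then show ?thesis using v(2)[of k] by simp
    qed
    have mid: "hscale H (of_real (1/2)) (v m + v n) \<in> V"
      using v(1) V(1) by (intro subspace_scale subspace_add) auto
    have "x - v m + (x - v n) = 2 *\<^sub>R (x - hscale H (of_real (1/2)) (v m + v n))"
      unfolding hscale_of_real by (simp add: algebra_simps scaleR_2)
    then have "norm (x - v m + (x - v n)) = 2 * norm (x - hscale H (of_real (1/2)) (v m + v n))"
      by simp
    then have "2 * d \<le> norm (x - v m + (x - v n))" using d_le[OF mid] by simp
    then have "(2 * d)\<^sup>2 \<le> (norm (x - v m + (x - v n)))\<^sup>2" using d0 by (intro power_mono) auto
    moreover have "(norm (x - v m))\<^sup>2 \<le> (d + 1 / Suc N)\<^sup>2" "(norm (x - v n))\<^sup>2 \<le> (d + 1 / Suc N)\<^sup>2"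
      using v_le mn by (auto intro!: power_mono)
    moreover have "(norm (v m - v n))\<^sup>2 = 2 * (norm (x - v m))\<^sup>2 + 2 * (norm (x - v n))\<^sup>2
        - (norm (x - v m + (x - v n)))\<^sup>2"
      using parallelogram[of "x - v m" "x - v n"] by (simp add: norm_minus_commute)
    ultimately have "(norm (v m - v n))\<^sup>2 \<le> 4 * (d + 1 / Suc N)\<^sup>2 - 4 * d\<^sup>2"
      by (simp add: power_mult_distrib)
    also have "\<dots> = 8 * d / Suc N + 4 * (1 / Suc N) * (1 / Suc N)"
      by (simp add: power2_eq_square algebra_simps)
    also have "\<dots> \<le> 8 * d / Suc N + 4 * (1 / Suc N) * 1"
      by (intro add_left_mono mult_left_mono) auto
    also have "\<dots> = 4 * (2 * d + 1) / Suc N" by (simp add: add_divide_distrib)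
    finally show ?thesis .
  qed
  have "Cauchy v"
  proof (rule metric_CauchyI)
    fix e :: real assume e: "0 < e"
    obtain N :: nat where N: "4 * (2 * d + 1) / e\<^sup>2 < N" using reals_Archimedean2 by blast
    have "dist (v m) (v n) < e" if "N \<le> m" "N \<le> n" for m n
    proof -
      have "4 * (2 * d + 1) < e\<^sup>2 * Suc N"
      proof -
        have "4 * (2 * d + 1) < e\<^sup>2 * N" using N e by (simp add: field_simps)
        also have "\<dots> \<le> e\<^sup>2 * Suc N" by (intro mult_left_mono) auto
        finally show ?thesis .
      qed
      then have "4 * (2 * d + 1) / Suc N < e\<^sup>2" by (simp add: field_simps)
      then have "(norm (v m - v n))\<^sup>2 < e\<^sup>2" using bound[OF that] by simp
      then show ?thesis using e by (simp add: dist_norm power2_less_imp_less)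
    qed
    then show "\<exists>N. \<forall>m\<ge>N. \<forall>n\<ge>N. dist (v m) (v n) < e" by blast
  qed
  then obtain y where y: "v \<longlonglongrightarrow> y" using Cauchy_convergent_iff convergent_def by blast
  have yV: "y \<in> V" using closed_sequentially[OF V(2) v(1) y] .
  have "(\<lambda>n. norm (x - v n)) \<longlonglongrightarrow> norm (x - y)" by (intro tendsto_intros y)
  moreover have "(\<lambda>n. d + 1 / Suc n) \<longlonglongrightarrow> d + 0"
    by (intro tendsto_add tendsto_const LIMSEQ_Suc[OF lim_1_over_n])
  ultimately have "norm (x - y) \<le> d"
    using v(2) by (intro LIMSEQ_le[of _ "norm (x - y)" _ d]) (auto intro: less_imp_le)
  then have min: "norm (x - y) \<le> norm (x - w)" if "w \<in> V" for w
    using d_le that by fastforce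
  have "hinner H (x - y) w = 0" if w: "w \<in> V" for w
  proof (cases "w = 0")
    case False
    \<comment> \<open>If \<open>x - y\<close> had a nonzero component \<open>?p\<close> along
      \<open>w\<close>, then \<open>y + ?p\<close> would be a strictly nearer point of
      \<open>V\<close>.\<close>
    let ?p = "hscale H (hinner H (x - y) w / of_real ((norm w)\<^sup>2)) w"
    have "y + ?p \<in> V" using yV w V(1) by (intro subspace_add subspace_scale)
    then have "norm (x - y) \<le> norm (x - y - ?p)" using min[of "y + ?p"] by (simp add: diff_diff_eq)
    then have "(norm (x - y))\<^sup>2 \<le> (norm (x - y - ?p))\<^sup>2" by (intro power_mono) auto
    then have "(norm (hinner H (x - y) w))\<^sup>2 / (norm w)\<^sup>2 \<le> 0"
      using norm_diff_component(2)[OF False, of "x - y"] by linarith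
    then show ?thesis using False by (simp add: divide_le_0_iff)
  qed simp
  then have "x - y \<in> orth H V" by (simp add: orth_def)
  moreover have "z = y" if z: "z \<in> V" "x - z \<in> orth H V" for z
  proof -
    have "y - z \<in> V" using z yV V(1) subspace_diff by blast
    moreover have "(x - z) - (x - y) \<in> orth H V"
      using z \<open>x - y \<in> orth H V\<close> subspace_orth subspace_diff by blast
    then have "y - z \<in> orth H V" by simp
    ultimately have "y - z = 0" using orth_int by blast
    then show ?thesis by simp
  qed
  ultimately show ?thesis using yV by blast
qed

definition pr :: "'a set \<Rightarrow> 'a \<Rightarrow> 'a" where
  "pr V x = (THE y. y \<in> V \<and> x - y \<in> orth H V)"

lemma proj_eq: "proj H V = Some \<circ> pr V"
  by (simp add: proj_def pr_def fun_eq_iff)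

end

locale closed_subspace = hilbert_space H
  for H :: "('k::real_or_complex, 'a::banach) hspace" +
  fixes V :: "'a set"
  assumes subspace: "subspace V" and closed: "closed V"
begin

lemma pr_in: "pr V x \<in> V" and pr_orth: "x - pr V x \<in> orth H V"
  using theI'[OF orth_decomposition[OF subspace closed, of x]] by (auto simp: pr_def)

lemma pr_unique: "y \<in> V \<Longrightarrow> x - y \<in> orth H V \<Longrightarrow> pr V x = y"
  using orth_decomposition[OF subspace closed, of x] pr_in pr_orth by blast

lemma pr_ident [simp]: "x \<in> V \<Longrightarrow> pr V x = x"
  using subspace_0[OF subspace_orth] by (simp add: pr_unique)

lemma pr_of_orth: "x \<in> orth H V \<Longrightarrow> pr V x = 0"
  using subspace_0[OF subspace] by (simp add: pr_unique)

lemma pr_add: "pr V (x + y) = pr V x + pr V y"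
proof (rule pr_unique)
  show "pr V x + pr V y \<in> V" using pr_in subspace subspace_add by blast
  have "(x - pr V x) + (y - pr V y) \<in> orth H V"
    using pr_orth subspace_orth subspace_add by blast
  then show "x + y - (pr V x + pr V y) \<in> orth H V" by (simp add: algebra_simps)
qed

lemma pr_hscale: "pr V (hscale H c x) = hscale H c (pr V x)"
proof (rule pr_unique)
  show "hscale H c (pr V x) \<in> V" using pr_in subspace subspace_scale by blast
  have "hscale H c (x - pr V x) \<in> orth H V"
    using pr_orth subspace_orth subspace_scale by blast
  then show "hscale H c x - hscale H c (pr V x) \<in> orth H V" by (simp add: scale_right_diff_distrib)
qed

lemma norm_pr_pythagoras: "(norm x)\<^sup>2 = (norm (pr V x))\<^sup>2 + (norm (x - pr V x))\<^sup>2"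
proof -
  have "hinner H (x - pr V x) (pr V x) = 0"
    by (rule orthD[OF pr_orth pr_in])
  from pythagoras[OF this] show ?thesis unfolding diff_add_cancel by linarith
qed

lemma norm_diff_pr: "(norm (x - pr V x))\<^sup>2 = (norm x)\<^sup>2 - (norm (pr V x))\<^sup>2"
  using norm_pr_pythagoras[of x] by linarith

lemma norm_pr_le: "norm (pr V x) \<le> norm x"
proof (rule power2_le_imp_le)
  show "(norm (pr V x))\<^sup>2 \<le> (norm x)\<^sup>2"
    using norm_diff_pr[of x] zero_le_power2[of "norm (x - pr V x)"] by linarith
qed simp

lemma hinner_pr: "hinner H (pr V x) y = hinner H x (pr V y)"
proof -
  have "hinner H (pr V x) (y - pr V y) = 0"
    using orthD[OF pr_orth pr_in] hinner_eq_0_commute by blast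
  moreover have "hinner H (x - pr V x) (pr V y) = 0" using orthD[OF pr_orth pr_in] .
  ultimately show ?thesis by (simp add: hinner_diff_left hinner_diff_right)
qed

lemma orth_orth: "orth H (orth H V) = V"
proof
  show "V \<subseteq> orth H (orth H V)"
    by (auto simp: orth_def) (metis hinner_eq_0_commute)
  show "orth H (orth H V) \<subseteq> V"
  proof
    fix x assume x: "x \<in> orth H (orth H V)"
    have "pr V x \<in> orth H (orth H V)" using pr_in \<open>V \<subseteq> orth H (orth H V)\<close> by blast
    then have "x - pr V x \<in> orth H (orth H V)" using x subspace_orth subspace_diff by blast
    then have "x - pr V x = 0" using pr_orth orth_int by blast
    then show "x \<in> V" using pr_in[of x] by simp
  qed
qed

lemma pr_orth_complement: "hilbert_space.pr H (orth H V) x = x - pr V x"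
proof -
  interpret O: closed_subspace H "orth H V"
    by unfold_locales (auto intro: subspace_orth closed_orth)
  show ?thesis using pr_in orth_orth by (intro O.pr_unique pr_orth) simp
qed

end

context hilbert_space
begin

lemma closed_subspace_orth: "closed_subspace H (orth H V)"
  by unfold_locales (auto intro: subspace_orth closed_orth)

lemma closed_subspace_closure: "subspace V \<Longrightarrow> closed_subspace H (closure V)"
  by unfold_locales (auto intro: subspace_closure)

lemma orth_orth_closure: "subspace V \<Longrightarrow> orth H (orth H V) = closure V"
  using closed_subspace.orth_orth[OF closed_subspace_closure] by simp

text \<open>The kernel is a closed subspace; a vector \<open>z\<close> orthogonal to it represents
  the functional up to a scalar, because \<phi>(z) x - \<phi>(x) z is in the kernel and hence
  orthogonal to \<open>z\<close>. Adjoints are obtained from this.\<close>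

theorem riesz_representation:
  assumes \<phi>: "bounded_linear \<phi>" and hom: "\<And>c x. \<phi> (hscale H c x) = c * \<phi> x"
  shows "\<exists>a. \<forall>x. \<phi> x = hinner H x a"
proof (cases "\<forall>x. \<phi> x = 0")
  case True
  then show ?thesis by (intro exI[of _ 0]) simp
next
  case False
  then obtain x0 where x0: "\<phi> x0 \<noteq> 0" by blast
  interpret \<phi>: bounded_linear \<phi> by fact
  define N where "N = {x. \<phi> x = 0}"
  interpret N: closed_subspace H N
  proof unfold_locales
    show "subspace N" by (auto simp: N_def subspace_def \<phi>.add hom \<phi>.zero)
    show "closed N" unfolding N_def
      by (intro closed_Collect_eq linear_continuous_on \<phi> continuous_on_const)
  qed
  define z where "z = x0 - pr N x0"
  have "\<phi> (pr N x0) = 0" using N.pr_in[of x0] by (simp add: N_def)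
  then have \<phi>z: "\<phi> z \<noteq> 0" using x0 by (simp add: z_def \<phi>.diff)
  then have z: "z \<noteq> 0" using \<phi>.zero by blast
  \<comment> \<open>The scalar carries a \<open>kconj\<close> because the inner product is
    conjugate-linear in its second argument.\<close>
  have "\<phi> x = hinner H x (hscale H (kconj (\<phi> z) / of_real ((norm z)\<^sup>2)) z)" for x
  proof -
    have "hscale H (\<phi> z) x - hscale H (\<phi> x) z \<in> N"
      by (simp add: N_def \<phi>.diff hom mult.commute)
    moreover have "z \<in> orth H N" unfolding z_def by (rule N.pr_orth)
    ultimately have "hinner H (hscale H (\<phi> z) x - hscale H (\<phi> x) z) z = 0"
      using orthD hinner_eq_0_commute by blast
    then have "\<phi> z * hinner H x z = \<phi> x * of_real ((norm z)\<^sup>2)"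
      by (simp add: hinner_diff_left hinner_hscale_left hinner_self)
    moreover have k: "kconj (kconj (\<phi> z) / of_real ((norm z)\<^sup>2)) = \<phi> z / of_real ((norm z)\<^sup>2)"
      by (simp add: divide_inverse kconj_mult flip: of_real_inverse of_real_power)
    ultimately show ?thesis
      unfolding hinner_hscale_right k using z by simp
  qed
  then show ?thesis by blast
qed

end

section \<open>Finite-dimensional subspaces and orthonormal bases\<close>

context hilbert_space
begin

text \<open>By the exchange lemma a basis of \<open>V\<close> has at most as many elements as any
  finite set whose span contains \<open>V\<close>. This form passes directly to subspaces and avoids
  the value 0 of \<open>dim\<close> on infinite-dimensional spaces.\<close>

lemma dim_at_most_iff:
  "dim_at_most H V r \<longleftrightarrow> subspace V \<and> (\<exists>F. finite F \<and> card F \<le> r \<and> V \<subseteq> span F)"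
proof
  assume V: "dim_at_most H V r"
  then obtain F where F: "finite F" "span F = V" "dim V \<le> r"
    unfolding dim_at_most_def by blast
  obtain G where G: "G \<subseteq> V" "independent G" "V \<subseteq> span G" "card G = dim V"
    using basis_exists by blast
  then have "finite G" using independent_span_bound[OF F(1) G(2)] F(2) by blast
  then show "subspace V \<and> (\<exists>F. finite F \<and> card F \<le> r \<and> V \<subseteq> span F)"
    using G F subspace_span by metis
next
  assume "subspace V \<and> (\<exists>F. finite F \<and> card F \<le> r \<and> V \<subseteq> span F)"
  then obtain F where F: "subspace V" "finite F" "card F \<le> r" "V \<subseteq> span F" by blast
  obtain G where G: "G \<subseteq> V" "independent G" "V \<subseteq> span G" "card G = dim V"
    using basis_exists by blast
  then have "finite G" "card G \<le> card F" using independent_span_bound[OF F(2) G(2)] F(4) by auto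
  moreover have "span G = V" using G F(1) by (meson span_subspace)
  ultimately show "dim_at_most H V r"
    unfolding dim_at_most_def using G F by auto
qed

lemma dim_at_most_mono: "dim_at_most H V r \<Longrightarrow> subspace W \<Longrightarrow> W \<subseteq> V \<Longrightarrow> dim_at_most H W r"
  unfolding dim_at_most_iff by blast

section \<open>Orthonormal sets, Fourier sums and Parseval's identity\<close>

definition orthonormal :: "'a set \<Rightarrow> bool" where
  "orthonormal E \<longleftrightarrow> (\<forall>e\<in>E. \<forall>f\<in>E. hinner H e f = (if e = f then 1 else 0))"

lemma is_onb_iff: "is_onb H E \<longleftrightarrow> orthonormal E \<and> closure (span E) = UNIV"
  by (simp add: is_onb_def orthonormal_def)

lemma orthonormal_subset: "orthonormal E \<Longrightarrow> F \<subseteq> E \<Longrightarrow> orthonormal F"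
  unfolding orthonormal_def by blast

lemma orthonormal_insert:
  assumes E: "orthonormal E" and x: "x \<noteq> 0" "x \<in> orth H E"
  shows "orthonormal (insert (hscale H (of_real (1 / norm x)) x) E)"
proof -
  let ?u = "hscale H (of_real (1 / norm x)) x"
  have "norm ?u = 1" using x by (simp add: norm_hscale norm_divide)
  then have "hinner H ?u ?u = 1" by (simp add: hinner_self)
  moreover have "hinner H ?u e = 0" "hinner H e ?u = 0" if "e \<in> E" for e
  proof -
    show "hinner H ?u e = 0" using x that by (simp add: hinner_hscale_left orth_def)
    then show "hinner H e ?u = 0" using hinner_eq_0_commute by blast
  qed
  ultimately show ?thesis using E unfolding orthonormal_def
    by (metis insert_iff zero_neq_one)
qed

lemma fourier_orth:
  assumes F: "finite F" "orthonormal F"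
  shows "x - (\<Sum>e\<in>F. hscale H (hinner H x e) e) \<in> orth H (span F)"
proof -
  have "hinner H (\<Sum>e\<in>F. hscale H (hinner H x e) e) f = hinner H x f" if "f \<in> F" for f
  proof -
    have "hinner H (\<Sum>e\<in>F. hscale H (hinner H x e) e) f
        = (\<Sum>e\<in>F. hinner H x e * hinner H e f)"
      by (simp add: hinner_sum_left hinner_hscale_left)
    also have "\<dots> = (\<Sum>e\<in>F. if e = f then hinner H x e else 0)"
      using F(2) that by (intro sum.cong) (auto simp: orthonormal_def)
    also have "\<dots> = hinner H x f" using F(1) that by simp
    finally show ?thesis .
  qed
  then show ?thesis unfolding orth_span by (simp add: orth_def hinner_diff_left)
qed

lemma fourier_in_span: "(\<Sum>e\<in>F. hscale H (hinner H x e) e) \<in> span F"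
  by (intro span_sum span_scale span_base)

lemma fourier_ident:
  assumes F: "finite F" "orthonormal F" and x: "x \<in> span F"
  shows "(\<Sum>e\<in>F. hscale H (hinner H x e) e) = x"
proof -
  have "x - (\<Sum>e\<in>F. hscale H (hinner H x e) e) \<in> span F"
    using x fourier_in_span span_diff by blast
  then have "x - (\<Sum>e\<in>F. hscale H (hinner H x e) e) = 0"
    using fourier_orth[OF F] orth_int by blast
  then show ?thesis by simp
qed

lemma fourier_pythagoras:
  assumes F: "finite F" "orthonormal F"
  shows "(norm x)\<^sup>2 = (\<Sum>e\<in>F. (norm (hinner H x e))\<^sup>2)
    + (norm (x - (\<Sum>e\<in>F. hscale H (hinner H x e) e)))\<^sup>2"
proof -
  let ?p = "\<Sum>e\<in>F. hscale H (hinner H x e) e"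
  have 0: "hinner H (x - ?p) ?p = 0"
    using fourier_orth[OF F] fourier_in_span orthD by blast
  then have "hinner H ?p ?p = hinner H x ?p" by (simp add: hinner_diff_left)
  also have "\<dots> = kconj (hinner H ?p x)" using hinner_kconj .
  also have "hinner H ?p x = (\<Sum>e\<in>F. hinner H x e * kconj (hinner H x e))"
    unfolding hinner_sum_left hinner_hscale_left by (metis hinner_kconj)
  also have "\<dots> = of_real (\<Sum>e\<in>F. (norm (hinner H x e))\<^sup>2)"
    unfolding kconj_mult_self by simp
  finally have "(of_real ((norm ?p)\<^sup>2) :: 'k) = of_real (\<Sum>e\<in>F. (norm (hinner H x e))\<^sup>2)"
    unfolding hinner_self kconj_of_real .
  then have "(norm ?p)\<^sup>2 = (\<Sum>e\<in>F. (norm (hinner H x e))\<^sup>2)" unfolding of_real_eq_iff .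
  then show ?thesis using pythagoras[OF 0] by simp
qed

lemma fourier_best_approximation:
  assumes F: "finite F" "orthonormal F" and y: "y \<in> span F"
  shows "norm (x - (\<Sum>e\<in>F. hscale H (hinner H x e) e)) \<le> norm (x - y)"
proof -
  define p where "p = (\<Sum>e\<in>F. hscale H (hinner H x e) e)"
  have "p - y \<in> span F" unfolding p_def using y fourier_in_span span_diff by blast
  then have "hinner H (x - p) (p - y) = 0"
    unfolding p_def using fourier_orth[OF F] orthD by blast
  from pythagoras[OF this] have "(norm (x - p))\<^sup>2 \<le> (norm (x - y))\<^sup>2"
    by simp
  then show ?thesis unfolding p_def by (rule power2_le_imp_le) simp
qed

text \<open>The cardinality may drop because a vector already in the span is discarded. The bound
  carries the rank over to orthonormal expansions.\<close>

lemma gram_schmidt: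
  "finite F \<Longrightarrow> \<exists>E. finite E \<and> orthonormal E \<and> span E = span F \<and> card E \<le> card F"
proof (induction F rule: finite_induct)
  case empty
  show ?case by (intro exI[of _ "{}"]) (simp add: orthonormal_def)
next
  case (insert x F)
  then obtain E where E: "finite E" "orthonormal E" "span E = span F" "card E \<le> card F" by blast
  define p where "p = (\<Sum>e\<in>E. hscale H (hinner H x e) e)"
  have p: "p \<in> span E" unfolding p_def by (rule fourier_in_span)
  show ?case
  proof (cases "x - p = 0")
    case True
    then have "x \<in> span F" using p E(3) by simp
    then have "span (insert x F) = span F" by (rule span_redundant)
    then show ?thesis using E insert by (intro exI[of _ E]) auto
  next
    case False
    define e where "e = hscale H (of_real (1 / norm (x - p))) (x - p)"
    have "x - p \<in> orth H E" using fourier_orth[OF E(1,2)] unfolding p_def orth_span .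
    then have "orthonormal (insert e E)"
      unfolding e_def using E(2) False by (intro orthonormal_insert)
    moreover have "span (insert e E) = span (insert x F)"
    proof (subst span_eq, intro conjI)
      have p1: "p \<in> span (insert x F)" and p2: "p \<in> span (insert e E)"
        using p E(3) span_mono[of F "insert x F"] span_mono[of E "insert e E"] by auto
      have "x - p \<in> span (insert x F)" using span_diff[OF span_base p1] by blast
      then have "e \<in> span (insert x F)" unfolding e_def by (rule span_scale)
      then show "insert e E \<subseteq> span (insert x F)"
        using E(3) span_superset[of E] span_mono[of F "insert x F"] by auto
      have "hscale H (of_real (norm (x - p))) e = x - p"
        using False by (simp add: e_def)
      then have "x = hscale H (of_real (norm (x - p))) e + p" by simp
      also have "\<dots> \<in> span (insert e E)" using span_add[OF span_scale[OF span_base] p2] by blast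
      finally show "insert x F \<subseteq> span (insert e E)"
        using E(3) span_superset[of F] span_mono[of E "insert e E"] by auto
    qed
    ultimately show ?thesis using E insert
      by (intro exI[of _ "insert e E"]) (auto simp: card_insert_if)
  qed
qed

text \<open>Zorn yields a maximal orthonormal set. Were its span not dense, the normalised residual
  of a vector outside the closure could be adjoined; by maximality it would already belong to the
  set, although it is orthogonal to it. This legitimises the choice made in
  \<open>onb\<close>.\<close>

theorem onb_exists: "\<exists>E. is_onb H E"
proof -
  have "\<exists>M\<in>{E. orthonormal E}. \<forall>X\<in>{E. orthonormal E}. M \<subseteq> X \<longrightarrow> X = M"
  proof (rule subset_Zorn')
    fix \<C> :: "'a set set" assume C: "subset.chain {E. orthonormal E} \<C>"
    have "hinner H e f = (if e = f then 1 else 0)" if ef: "e \<in> \<Union>\<C>" "f \<in> \<Union>\<C>" for e f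
    proof -
      obtain E1 E2 where *: "e \<in> E1" "E1 \<in> \<C>" "f \<in> E2" "E2 \<in> \<C>"
        using ef by blast
      have on: "orthonormal E1" "orthonormal E2"
        using C * unfolding subset_chain_def by (meson mem_Collect_eq subsetD)+
      have "E1 \<subseteq> E2 \<or> E2 \<subseteq> E1"
        using C * unfolding subset_chain_def by (meson bspec)
      then have "e \<in> E2 \<or> f \<in> E1" using * by (meson subsetD)
      then show ?thesis using on * unfolding orthonormal_def by (meson bspec)
    qed
    then show "\<Union>\<C> \<in> {E. orthonormal E}" unfolding mem_Collect_eq orthonormal_def by blast
  qed
  then obtain E where E: "orthonormal E" "\<And>X. orthonormal X \<Longrightarrow> E \<subseteq> X \<Longrightarrow> X = E"
    by (metis mem_Collect_eq)
  interpret V: closed_subspace H "closure (span E)"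
    by (intro closed_subspace_closure subspace_span)
  have "x \<in> closure (span E)" for x
  proof (rule ccontr)
    assume x: "x \<notin> closure (span E)"
    let ?y = "x - pr (closure (span E)) x"
    let ?u = "hscale H (of_real (1 / norm ?y)) ?y"
    have y: "?y \<noteq> 0" using x V.pr_in[of x] by (metis right_minus_eq)
    have orth: "?y \<in> orth H E" using V.pr_orth[of x] by (simp add: orth_span)
    have "insert ?u E = E" by (rule E(2)[OF orthonormal_insert[OF E(1) y orth] subset_insertI])
    then have "?u \<in> E" by blast
    then have "hinner H ?y ?u = 0" by (rule orthD[OF orth])
    then have "hinner H ?y ?y = 0" using y unfolding hinner_hscale_right by simp
    then show False using y hinner_self_eq_0 by blast
  qed
  then have "closure (span E) = UNIV" by blast
  then show ?thesis using E(1) is_onb_iff by blast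
qed

lemma is_onb_onb: "is_onb H (onb H)"
  unfolding onb_def using onb_exists by (rule someI_ex)

text \<open>Finite partial sums are bounded by Bessel's inequality; the reverse estimate combines
  density of the span with the best-approximation property of Fourier sums.\<close>

theorem parseval:
  assumes E: "is_onb H E"
  shows "((\<lambda>e. (norm (hinner H x e))\<^sup>2) has_sum (norm x)\<^sup>2) E"
proof -
  let ?f = "\<lambda>e. (norm (hinner H x e))\<^sup>2"
  have on: "orthonormal F" if "F \<subseteq> E" for F
    using E that orthonormal_subset is_onb_iff by blast
  have le: "sum ?f F \<le> (norm x)\<^sup>2" if "finite F" "F \<subseteq> E" for F
    using fourier_pythagoras[OF that(1) on[OF that(2)], of x]
      zero_le_power2[of "norm (x - (\<Sum>e\<in>F. hscale H (hinner H x e) e))"] by linarith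
  then have "?f summable_on E"
    by (intro nonneg_bdd_above_summable_on) (auto simp: bdd_above_def)
  then obtain s where s: "(?f has_sum s) E" by (auto simp: summable_on_def)
  have "s \<le> (norm x)\<^sup>2" using s le by (rule has_sum_le_finite_sums)
  moreover have "(norm x)\<^sup>2 \<le> s + \<epsilon>" if \<epsilon>: "0 < \<epsilon>" for \<epsilon>
  proof -
    have "x \<in> closure (span E)" using E is_onb_iff by simp
    then obtain y where y: "y \<in> span E" "dist y x < sqrt \<epsilon>"
      using \<epsilon> unfolding closure_approachable by (meson real_sqrt_gt_zero)
    \<comment> \<open>An element of the span involves only finitely many basis vectors, so the
      Fourier sum over these is at least as close to \<open>x\<close> as \<open>y\<close>
      is.\<close>
    then obtain F where F: "finite F" "F \<subseteq> E" "y \<in> span F"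
      unfolding span_explicit by blast
    let ?d = "norm (x - (\<Sum>e\<in>F. hscale H (hinner H x e) e))"
    have "?d \<le> norm (x - y)" by (rule fourier_best_approximation[OF F(1) on[OF F(2)] F(3)])
    then have "?d \<le> sqrt \<epsilon>" using y(2) by (simp add: dist_norm norm_minus_commute)
    then have "?d\<^sup>2 \<le> (sqrt \<epsilon>)\<^sup>2" by (intro power_mono) auto
    then have "?d\<^sup>2 \<le> \<epsilon>" using that by simp
    moreover have "sum ?f F \<le> s"
      using s F by (intro has_sum_mono_neutral[OF has_sum_finite s]) auto
    ultimately show ?thesis using fourier_pythagoras[OF F(1) on[OF F(2)], of x] by linarith
  qed
  then have "(norm x)\<^sup>2 \<le> s" by (rule field_le_epsilon)
  ultimately show ?thesis using s by simp
qed

end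

section \<open>Hilbert--Schmidt operators\<close>

text \<open>Tonelli for a nonnegative double family: iterated summability gives summability over the
  product, where the order of summation can be exchanged.\<close>

lemma has_sum_swap_nonneg:
  fixes g :: "'a \<Rightarrow> 'b \<Rightarrow> real"
  assumes "\<And>e. e \<in> E \<Longrightarrow> (g e has_sum a e) F" "\<And>f. f \<in> F \<Longrightarrow> ((\<lambda>e. g e f) has_sum b f) E"
    and "\<And>e f. 0 \<le> g e f" and "(a has_sum s) E"
  shows "(b has_sum s) F"
proof -
  have "(\<lambda>(e, f). g e f) summable_on E \<times> F"
    using assms by (intro summable_on_SigmaI[where g = a]) (auto simp: summable_on_def)
  then have "((\<lambda>(e, f). g e f) has_sum s) (E \<times> F)"
    using assms by (intro has_sum_SigmaI[where g = a]) auto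
  then have "((\<lambda>(f, e). g e f) has_sum s) (F \<times> E)"
    by (subst (asm) has_sum_swap) simp
  then show ?thesis
    by (rule has_sum_SigmaD) (use assms in auto)
qed

text \<open>The total-function counterpart of \<open>bounded_ops\<close>. As
  \<open>bounded_linear\<close> is linearity over the reals only, homogeneity over the scalar field
  is added.\<close>

definition blin ::
  "('k::real_or_complex, 'a::banach) hspace \<Rightarrow> ('k, 'b::banach) hspace \<Rightarrow> ('a \<Rightarrow> 'b) \<Rightarrow> bool" where
  "blin H K t \<longleftrightarrow> bounded_linear t \<and> (\<forall>c x. t (hscale H c x) = hscale K c (t x))"

definition hs ::
  "('k::real_or_complex, 'a::banach) hspace \<Rightarrow> ('k, 'b::banach) hspace \<Rightarrow> ('a \<Rightarrow> 'b) \<Rightarrow> bool" where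
  "hs H K t \<longleftrightarrow> blin H K t \<and> (\<lambda>e. (norm (t e))\<^sup>2) summable_on onb H"

text \<open>The square of \<open>hs_norm\<close>, which is the quantity that Pythagoras adds up. It
  defaults to 0 when the family is not summable, so it represents a norm only together with
  \<open>hs\<close>.\<close>

definition hsq :: "('k::real_or_complex, 'a::banach) hspace \<Rightarrow> ('a \<Rightarrow> 'b::banach) \<Rightarrow> real" where
  "hsq H t = (\<Sum>\<^sub>\<infinity>e\<in>onb H. (norm (t e))\<^sup>2)"

lemma hs_norm_Some: "hs_norm H (Some \<circ> t) = sqrt (hsq H t)"
  by (simp add: hs_norm_def hsq_def)

lemma hsq_nonneg: "0 \<le> hsq H t"
  unfolding hsq_def by (intro infsum_nonneg) auto

lemma blin_comp: "blin H K t \<Longrightarrow> blin G H u \<Longrightarrow> blin G K (\<lambda>x. t (u x))"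
  by (simp add: blin_def bounded_linear_compose)

lemma blin_bounded_linear: "blin H K t \<Longrightarrow> bounded_linear t"
  by (simp add: blin_def)

lemma blin_hscale: "blin H K t \<Longrightarrow> t (hscale H c x) = hscale K c (t x)"
  by (simp add: blin_def)

lemma blin_add: "blin H K t \<Longrightarrow> t (x + y) = t x + t y"
  using blin_bounded_linear bounded_linear.linear linear_add by blast

lemma blin_diff: "blin H K t \<Longrightarrow> t (x - y) = t x - t y"
  using blin_bounded_linear bounded_linear.linear linear_diff by blast

lemma blin_zero: "blin H K t \<Longrightarrow> t 0 = 0"
  using blin_bounded_linear bounded_linear.linear linear_0 by blast

lemma (in closed_subspace) blin_pr: "blin H H (pr V)"
  unfolding blin_def
proof (intro conjI allI)
  show "bounded_linear (pr V)"
  proof (rule bounded_linear_intro)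
    show "pr V (t *\<^sub>R x) = t *\<^sub>R pr V x" for t x
      using pr_hscale[of "of_real t" x] by (simp add: hscale_of_real)
    show "norm (pr V x) \<le> norm x * 1" for x using norm_pr_le by simp
  qed (rule pr_add)
qed (rule pr_hscale)

locale hilbert_pair = H: hilbert_space H + K: hilbert_space K
  for H :: "('k::real_or_complex, 'a::banach) hspace" and K :: "('k, 'b::banach) hspace"
begin

lemma bounded_ops_iff: "T \<in> bounded_ops H K \<longleftrightarrow> (\<exists>t. T = Some \<circ> t \<and> blin H K t)"
proof
  assume T: "T \<in> bounded_ops H K"
  define t where "t x = the (T x)" for x
  have d: "dom T = UNIV" using T by (simp add: bounded_ops_def)
  have "T = Some \<circ> t"
  proof
    show "T x = (Some \<circ> t) x" for x
      using d UNIV_I[of x] by (auto simp: t_def simp flip: d)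
  qed
  moreover have "blin H K t"
    unfolding blin_def
  proof (intro conjI allI)
    show hom: "t (hscale H c x) = hscale K c (t x)" for c x
      using T d by (simp add: bounded_ops_def lin_op_def t_def)
    obtain c where c: "\<And>x. norm (t x) \<le> c * norm x"
      using T by (auto simp: bounded_ops_def t_def)
    show "bounded_linear t"
    proof (rule bounded_linear_intro)
      show "t (x + y) = t x + t y" for x y
        using T d by (simp add: bounded_ops_def lin_op_def t_def)
      show "t (s *\<^sub>R x) = s *\<^sub>R t x" for s x
        using hom[of "of_real s" x] by (simp add: H.hscale_of_real K.hscale_of_real)
      show "norm (t x) \<le> norm x * c" for x using c by (simp add: mult.commute)
    qed
  qed
  ultimately show "\<exists>t. T = Some \<circ> t \<and> blin H K t" by blast
next
  assume "\<exists>t. T = Some \<circ> t \<and> blin H K t"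
  then obtain t where t: "T = Some \<circ> t" "blin H K t" by blast
  have "\<exists>c. \<forall>x. norm (t x) \<le> c * norm x"
    using bounded_linear.bounded[OF blin_bounded_linear[OF t(2)]] by (auto simp: mult.commute)
  moreover have "dom (Some \<circ> t) = UNIV" by auto
  ultimately show "T \<in> bounded_ops H K"
    using t by (simp add: bounded_ops_def lin_op_def blin_add blin_hscale)
qed

lemma hs_ops_iff: "T \<in> hs_ops H K \<longleftrightarrow> (\<exists>t. T = Some \<circ> t \<and> hs H K t)"
  unfolding hs_ops_def hs_def using bounded_ops_iff by auto

section \<open>Adjoints and the Hilbert-Schmidt norm\<close>

definition adj :: "('a \<Rightarrow> 'b) \<Rightarrow> 'b \<Rightarrow> 'a" where
  "adj t = (SOME s. \<forall>x y. hinner K (t x) y = hinner H x (s y))"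

lemma adj:
  assumes t: "blin H K t"
  shows "hinner K (t x) y = hinner H x (adj t y)"
proof -
  have "\<exists>a. \<forall>x. hinner K (t x) y = hinner H x a" for y
  proof (rule H.riesz_representation)
    show "bounded_linear (\<lambda>x. hinner K (t x) y)"
      using bounded_linear_compose[OF K.bounded_linear_hinner_left blin_bounded_linear[OF t]] .
  qed (simp add: blin_hscale[OF t] K.hinner_hscale_left)
  then have "\<exists>s. \<forall>x y. hinner K (t x) y = hinner H x (s y)" by metis
  then have "\<forall>x y. hinner K (t x) y = hinner H x (adj t y)" unfolding adj_def by (rule someI_ex)
  then show ?thesis by blast
qed

lemma adj_unique:
  assumes "blin H K t" "\<And>x y. hinner K (t x) y = hinner H x (s y)"
  shows "adj t = s"
proof (intro ext H.hinner_ext)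
  show "hinner H x (adj t y) = hinner H x (s y)" for x y
    using adj[OF assms(1)] assms(2) by metis
qed

text \<open>By Parseval in either space, both sums are iterated sums of the same family of squared
  moduli of the inner products of \<open>t e\<close> with \<open>f\<close>, taken in opposite
  order.\<close>

lemma hs_sum_adj_iff:
  assumes t: "blin H K t" and E: "is_onb H E" and F: "is_onb K F"
  shows "((\<lambda>e. (norm (t e))\<^sup>2) has_sum s) E \<longleftrightarrow> ((\<lambda>f. (norm (adj t f))\<^sup>2) has_sum s) F"
proof -
  let ?g = "\<lambda>e f. (norm (hinner K (t e) f))\<^sup>2"
  have e: "(?g e has_sum (norm (t e))\<^sup>2) F" for e by (rule K.parseval[OF F])
  have "?g e f = (norm (hinner H (adj t f) e))\<^sup>2" for e f
    by (simp add: adj[OF t] H.norm_hinner_commute[of e])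
  then have f: "((\<lambda>e. ?g e f) has_sum (norm (adj t f))\<^sup>2) E" for f
    using H.parseval[OF E, of "adj t f"] by simp
  show ?thesis
  proof
    show "((\<lambda>f. (norm (adj t f))\<^sup>2) has_sum s) F" if "((\<lambda>e. (norm (t e))\<^sup>2) has_sum s) E"
      by (rule has_sum_swap_nonneg[OF e f _ that]) auto
    show "((\<lambda>e. (norm (t e))\<^sup>2) has_sum s) E" if "((\<lambda>f. (norm (adj t f))\<^sup>2) has_sum s) F"
      by (rule has_sum_swap_nonneg[OF f e _ that]) auto
  qed
qed

lemma hs_has_sum: "hs H K t \<Longrightarrow> ((\<lambda>e. (norm (t e))\<^sup>2) has_sum hsq H t) (onb H)"
  by (simp add: hs_def hsq_def)

lemma hsI: "blin H K t \<Longrightarrow> ((\<lambda>e. (norm (t e))\<^sup>2) has_sum s) (onb H) \<Longrightarrow> hs H K t"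
  by (auto simp: hs_def summable_on_def)

lemma hsq_eqI: "((\<lambda>e. (norm (t e))\<^sup>2) has_sum s) (onb H) \<Longrightarrow> hsq H t = s"
  unfolding hsq_def by (rule infsumI)

lemma hs_blin: "hs H K t \<Longrightarrow> blin H K t"
  by (simp add: hs_def)

lemma closed_subspace_kernel:
  assumes t: "blin H K t"
  shows "closed_subspace H {x. t x = 0}"
proof unfold_locales
  show "H.subspace {x. t x = 0}"
    using t K.scale_zero_right by (auto simp: H.subspace_def blin_add blin_hscale blin_zero)
  show "closed {x. t x = 0}"
    by (intro closed_Collect_eq linear_continuous_on blin_bounded_linear[OF t] continuous_on_const)
qed

text \<open>The kernel is a closed subspace containing the orthonormal basis, hence
  everything.\<close>

lemma hs_eq_0:
  assumes t: "hs H K t" and 0: "hsq H t = 0"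
  shows "t x = 0"
proof -
  interpret N: closed_subspace H "{x. t x = 0}" by (rule closed_subspace_kernel[OF hs_blin[OF t]])
  have "(norm (t e))\<^sup>2 = 0" if "e \<in> onb H" for e
    using hs_has_sum[OF t] 0 that
    by (intro nonneg_has_sum_le_0D[where f = "\<lambda>e. (norm (t e))\<^sup>2" and A = "onb H"]) auto
  then have onb: "onb H \<subseteq> {x. t x = 0}" by auto
  have "closure (H.span (onb H)) \<subseteq> {x. t x = 0}"
    by (intro closure_minimal H.span_minimal onb N.subspace N.closed)
  then show ?thesis using H.is_onb_onb H.is_onb_iff by blast
qed

lemma blin_plus: "blin H K t \<Longrightarrow> blin H K u \<Longrightarrow> blin H K (\<lambda>x. t x + u x)"
  by (simp add: blin_def bounded_linear_add K.scale_right_distrib)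

lemma blin_minus: "blin H K t \<Longrightarrow> blin H K u \<Longrightarrow> blin H K (\<lambda>x. t x - u x)"
  by (simp add: blin_def bounded_linear_sub K.scale_right_diff_distrib)

lemma blin_0: "blin H K (\<lambda>x. 0)"
  by (simp add: blin_def)

lemma L2_set_le_hsq:
  assumes t: "hs H K t" and F: "finite F" "F \<subseteq> onb H"
  shows "L2_set (\<lambda>e. norm (t e)) F \<le> sqrt (hsq H t)"
  unfolding L2_set_def using F
  by (intro real_sqrt_le_mono has_sum_mono_neutral[OF has_sum_finite hs_has_sum[OF t]]) auto

text \<open>Bounds over finite parts of the basis suffice, so the triangle inequality for operators
  reduces to the finite one for \<open>L2_set\<close>.\<close>

lemma hs_boundI:
  assumes t: "blin H K t" and "\<And>F. finite F \<Longrightarrow> F \<subseteq> onb H \<Longrightarrow> L2_set (\<lambda>e. norm (t e)) F \<le> c"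
  shows "hs H K t \<and> sqrt (hsq H t) \<le> c"
proof -
  have c: "0 \<le> c" using assms(2)[of "{}"] by simp
  have le: "(\<Sum>e\<in>F. (norm (t e))\<^sup>2) \<le> c\<^sup>2" if "finite F" "F \<subseteq> onb H" for F
    using assms(2)[OF that] unfolding L2_set_def by (rule sqrt_le_D)
  then have "(\<lambda>e. (norm (t e))\<^sup>2) summable_on onb H"
    by (intro nonneg_bdd_above_summable_on) (auto simp: bdd_above_def)
  then have hs: "hs H K t" using t by (simp add: hs_def)
  have "hsq H t \<le> c\<^sup>2" using hs_has_sum[OF hs] le by (rule has_sum_le_finite_sums)
  then show ?thesis using hs c real_le_lsqrt by blast
qed

lemma hs_plus:
  assumes t: "hs H K t" and u: "hs H K u"
  shows "hs H K (\<lambda>x. t x + u x) \<and> sqrt (hsq H (\<lambda>x. t x + u x)) \<le> sqrt (hsq H t) + sqrt (hsq H u)"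
proof (rule hs_boundI)
  fix F assume F: "finite F" "F \<subseteq> onb H"
  have "L2_set (\<lambda>e. norm (t e + u e)) F \<le> L2_set (\<lambda>e. norm (t e) + norm (u e)) F"
    by (intro L2_set_mono norm_triangle_ineq) auto
  also have "\<dots> \<le> L2_set (\<lambda>e. norm (t e)) F + L2_set (\<lambda>e. norm (u e)) F"
    by (rule L2_set_triangle_ineq)
  also have "\<dots> \<le> sqrt (hsq H t) + sqrt (hsq H u)"
    by (intro add_mono L2_set_le_hsq t u F)
  finally show "L2_set (\<lambda>e. norm (t e + u e)) F \<le> sqrt (hsq H t) + sqrt (hsq H u)" .
qed (intro blin_plus hs_blin t u)

lemma hs_uminus:
  assumes t: "hs H K t"
  shows "hs H K (\<lambda>x. - t x)"
  using t blin_minus[OF blin_0 hs_blin[OF t]] by (simp add: hs_def)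

lemma hs_minus: "hs H K t \<Longrightarrow> hs H K u \<Longrightarrow> hs H K (\<lambda>x. t x - u x)"
  using hs_plus[of t "\<lambda>x. - u x"] hs_uminus[of u] by simp

lemma hs_0: "hs H K (\<lambda>x. 0)" "hsq H (\<lambda>x. 0::'b) = 0"
  by (simp_all add: hs_def blin_0 hsq_def)

lemma hs_sum:
  assumes "\<And>i. i \<in> I \<Longrightarrow> hs H K (t i)"
  shows "hs H K (\<lambda>x. \<Sum>i\<in>I. t i x) \<and> sqrt (hsq H (\<lambda>x. \<Sum>i\<in>I. t i x)) \<le> (\<Sum>i\<in>I. sqrt (hsq H (t i)))"
  using assms
proof (induction I rule: infinite_finite_induct)
  case (insert i I)
  then show ?case using hs_plus[of "t i" "\<lambda>x. \<Sum>i\<in>I. t i x"] by fastforce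
qed (auto simp: hs_0)

text \<open>Summing over the basis is Parseval for \<open>a\<close>, scaled by the norm of
  \<open>b\<close>.\<close>

lemma hs_rank_one:
  shows "hs H K (\<lambda>x. hscale K (hinner H x a) b)"
    and "sqrt (hsq H (\<lambda>x. hscale K (hinner H x a) b)) = norm a * norm b"
proof -
  have "blin H K (\<lambda>x. hscale K (hinner H x a) b)"
    unfolding blin_def
  proof (intro conjI allI)
    show "bounded_linear (\<lambda>x. hscale K (hinner H x a) b)"
    proof (rule bounded_linear_intro)
      show "hscale K (hinner H (s *\<^sub>R x) a) b = s *\<^sub>R hscale K (hinner H x a) b" for s x
        using H.hinner_hscale_left[of "of_real s" x a]
        by (simp add: H.hscale_of_real flip: K.hscale_of_real)
      show "norm (hscale K (hinner H x a) b) \<le> norm x * (norm a * norm b)" for x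
        using mult_right_mono[OF H.norm_hinner_le[of x a], of "norm b"]
        by (simp add: K.norm_hscale mult.assoc)
    qed (simp add: H.hinner_add_left K.scale_left_distrib)
  qed (simp add: H.hinner_hscale_left)
  moreover have "((\<lambda>e. (norm (hscale K (hinner H e a) b))\<^sup>2) has_sum ((norm a)\<^sup>2 * (norm b)\<^sup>2)) (onb H)"
    using has_sum_cmult_left[OF H.parseval[OF H.is_onb_onb, of a], of "(norm b)\<^sup>2"]
    by (simp add: K.norm_hscale power_mult_distrib H.norm_hinner_commute[of _ a])
  ultimately show "hs H K (\<lambda>x. hscale K (hinner H x a) b)"
    "sqrt (hsq H (\<lambda>x. hscale K (hinner H x a) b)) = norm a * norm b"
    using hsI hsq_eqI[of "\<lambda>x. hscale K (hinner H x a) b"]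
    by (auto simp: real_sqrt_mult)
qed

lemma hs_finite_rank: "hs H K (\<lambda>x. \<Sum>i\<in>I. hscale K (hinner H x (a i)) (b i))"
  by (intro hs_sum[THEN conjunct1] hs_rank_one)

text \<open>Expand \<open>t x\<close> in an orthonormal set spanning a space that contains the
  range; the coefficient at \<open>v\<close> is the inner product of \<open>x\<close> with
  \<open>adj t v\<close>. The orthonormal vectors serve as their own indices.\<close>

lemma finite_rank_decomposition:
  assumes t: "blin H K t" and r: "dim_at_most K (range t) r"
  obtains I :: "'b set" and a where "finite I" "card I \<le> r"
    "t = (\<lambda>x. \<Sum>v\<in>I. hscale K (hinner H x (a v)) v)"
proof -
  obtain F where F: "finite F" "card F \<le> r" "range t \<subseteq> K.span F"
    using r K.dim_at_most_iff by blast
  obtain I where I: "finite I" "K.orthonormal I" "K.span I = K.span F" "card I \<le> card F"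
    using K.gram_schmidt[OF F(1)] by blast
  have "t x = (\<Sum>v\<in>I. hscale K (hinner H x (adj t v)) v)" for x
  proof -
    have "t x \<in> K.span I" using F(3) I(3) by blast
    from K.fourier_ident[OF I(1,2) this] show ?thesis by (simp add: adj[OF t])
  qed
  then have "t = (\<lambda>x. \<Sum>v\<in>I. hscale K (hinner H x (adj t v)) v)" by (rule ext)
  moreover have "card I \<le> r" using I(4) F(2) by simp
  ultimately show thesis by (intro that[OF I(1)])
qed

text \<open>Changing one factor at a time writes each difference of rank-one operators as one with
  factors \<open>a i - a' i\<close>, \<open>b i\<close> plus one with factors \<open>a' i\<close>,
  \<open>b i - b' i\<close>.\<close>

lemma hs_finite_rank_diff:
  "sqrt (hsq H (\<lambda>x. (\<Sum>i\<in>I. hscale K (hinner H x (a i)) (b i))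
      - (\<Sum>i\<in>I. hscale K (hinner H x (a' i)) (b' i))))
    \<le> (\<Sum>i\<in>I. norm (a i - a' i) * norm (b i) + norm (a' i) * norm (b i - b' i))"
proof -
  let ?u = "\<lambda>i x. hscale K (hinner H x (a i - a' i)) (b i)"
  let ?v = "\<lambda>i x. hscale K (hinner H x (a' i)) (b i - b' i)"
  have "(\<lambda>x. (\<Sum>i\<in>I. hscale K (hinner H x (a i)) (b i))
      - (\<Sum>i\<in>I. hscale K (hinner H x (a' i)) (b' i))) = (\<lambda>x. \<Sum>i\<in>I. ?u i x + ?v i x)"
    by (simp add: sum_subtractf[symmetric] H.hinner_diff_right K.scale_left_diff_distrib
        K.scale_right_diff_distrib)
  moreover have "sqrt (hsq H (\<lambda>x. \<Sum>i\<in>I. ?u i x + ?v i x))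
      \<le> (\<Sum>i\<in>I. sqrt (hsq H (\<lambda>x. ?u i x + ?v i x)))"
    by (intro hs_sum[THEN conjunct2] hs_plus[THEN conjunct1] hs_rank_one)
  moreover have "\<dots> \<le> (\<Sum>i\<in>I. sqrt (hsq H (?u i)) + sqrt (hsq H (?v i)))"
    by (intro sum_mono hs_plus[THEN conjunct2] hs_rank_one)
  ultimately show ?thesis by (simp add: hs_rank_one(2))
qed

section \<open>Pythagoras for compressions by projectors\<close>

lemma hs_split_left:
  assumes t: "hs H K t" and W: "closed_subspace K W"
  shows "hs H K (\<lambda>x. K.pr W (t x))"
    and "hsq H t = hsq H (\<lambda>x. K.pr W (t x)) + hsq H (\<lambda>x. t x - K.pr W (t x))"
proof -
  interpret W: closed_subspace K W by fact
  have b: "blin H K (\<lambda>x. K.pr W (t x))"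
    using blin_comp[OF W.blin_pr hs_blin[OF t]] .
  have "(\<lambda>e. (norm (K.pr W (t e)))\<^sup>2) summable_on onb H"
    using t by (auto simp: hs_def intro!: summable_on_comparison_test[where f = "\<lambda>e. (norm (t e))\<^sup>2"]
        power_mono W.norm_pr_le)
  then show p: "hs H K (\<lambda>x. K.pr W (t x))" using b by (simp add: hs_def)
  have "hs H K (\<lambda>x. t x - K.pr W (t x))" using t p by (rule hs_minus)
  from has_sum_add[OF hs_has_sum[OF p] hs_has_sum[OF this]]
  show "hsq H t = hsq H (\<lambda>x. K.pr W (t x)) + hsq H (\<lambda>x. t x - K.pr W (t x))"
    by (intro hsq_eqI) (simp add: W.norm_diff_pr)
qed

text \<open>Passing to the adjoint turns composition with the projector into a pointwise projection.\<close>

lemma hs_split_right: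
  assumes t: "hs H K t" and V: "closed_subspace H V"
  shows "hs H K (\<lambda>x. t (H.pr V x))"
    and "hsq H t = hsq H (\<lambda>x. t (H.pr V x)) + hsq H (\<lambda>x. t x - t (H.pr V x))"
proof -
  interpret V: closed_subspace H V by fact
  note onbs = H.is_onb_onb K.is_onb_onb
  have bt: "blin H K t" using t by (rule hs_blin)
  have bp: "blin H K (\<lambda>x. t (H.pr V x))" using blin_comp[OF bt V.blin_pr] .
  have bd: "blin H K (\<lambda>x. t x - t (H.pr V x))" using bt bp by (rule blin_minus)
  have ap: "adj (\<lambda>x. t (H.pr V x)) = (\<lambda>y. H.pr V (adj t y))"
    by (rule adj_unique[OF bp]) (simp add: adj[OF bt] V.hinner_pr)
  have ad: "adj (\<lambda>x. t x - t (H.pr V x)) = (\<lambda>y. adj t y - H.pr V (adj t y))"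
    by (rule adj_unique[OF bd])
       (simp add: adj[OF bt] V.hinner_pr K.hinner_diff_left H.hinner_diff_right)
  have T: "((\<lambda>f. (norm (adj t f))\<^sup>2) has_sum hsq H t) (onb K)"
    using hs_has_sum[OF t] hs_sum_adj_iff[OF bt onbs] by simp
  have "(\<lambda>f. (norm (H.pr V (adj t f)))\<^sup>2) summable_on onb K"
    by (rule summable_on_comparison_test[where f = "\<lambda>f. (norm (adj t f))\<^sup>2"])
       (use T in \<open>auto simp: summable_on_def intro!: power_mono V.norm_pr_le\<close>)
  then obtain s where s: "((\<lambda>f. (norm (H.pr V (adj t f)))\<^sup>2) has_sum s) (onb K)"
    by (auto simp: summable_on_def)
  then have s': "((\<lambda>e. (norm (t (H.pr V e)))\<^sup>2) has_sum s) (onb H)"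
    unfolding hs_sum_adj_iff[OF bp onbs] ap .
  then show "hs H K (\<lambda>x. t (H.pr V x))" using hsI bp by blast
  have "((\<lambda>f. (norm (adj t f))\<^sup>2 - (norm (H.pr V (adj t f)))\<^sup>2) has_sum hsq H t - s) (onb K)"
    using has_sum_add[OF T, of "\<lambda>f. - (norm (H.pr V (adj t f)))\<^sup>2" "- s"] s
    by (simp add: has_sum_uminus)
  then have "((\<lambda>f. (norm (adj t f - H.pr V (adj t f)))\<^sup>2) has_sum hsq H t - s) (onb K)"
    by (simp add: V.norm_diff_pr)
  then have "((\<lambda>e. (norm (t e - t (H.pr V e)))\<^sup>2) has_sum hsq H t - s) (onb H)"
    unfolding hs_sum_adj_iff[OF bd onbs] ad .
  then show "hsq H t = hsq H (\<lambda>x. t (H.pr V x)) + hsq H (\<lambda>x. t x - t (H.pr V x))"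
    using hsq_eqI[OF s'] hsq_eqI[of "\<lambda>x. t x - t (H.pr V x)"] by fastforce
qed

lemma hs_split:
  assumes t: "hs H K t" and V: "closed_subspace H V" and W: "closed_subspace K W"
  shows "hs H K (\<lambda>x. K.pr W (t (H.pr V x)))"
    and "hsq H t = hsq H (\<lambda>x. K.pr W (t (H.pr V x))) + hsq H (\<lambda>x. t x - K.pr W (t (H.pr V x)))"
proof -
  interpret V: closed_subspace H V by fact
  note p = hs_split_right(1)[OF t V]
  note pp = hs_split_left[OF p W]
  show q: "hs H K (\<lambda>x. K.pr W (t (H.pr V x)))" by (rule pp)
  have "hs H K (\<lambda>x. t x - K.pr W (t (H.pr V x)))" using t q by (rule hs_minus)
  \<comment> \<open>With P, Q the two projectors, splitting the residual t - P t Q on the right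
    gives t Q - P t Q and t - t Q. These are the defects left by splitting t on the right and then t
    Q on the left.\<close>
  from hs_split_right(2)[OF this V] pp(2) hs_split_right(2)[OF t V]
  show "hsq H t = hsq H (\<lambda>x. K.pr W (t (H.pr V x))) + hsq H (\<lambda>x. t x - K.pr W (t (H.pr V x)))"
    using V.pr_in by (simp add: fun_eq_iff)
qed

section \<open>Images, kernels, ranges and the domain of the Moore-Penrose inverse\<close>

lemma subspace_image:
  assumes sub: "H.subspace V"
    and add: "\<And>x y. x \<in> V \<Longrightarrow> y \<in> V \<Longrightarrow> f (x + y) = f x + f y"
    and scale: "\<And>c x. x \<in> V \<Longrightarrow> f (hscale H c x) = hscale K c (f x)"
  shows "K.subspace (f ` V)"
  unfolding K.subspace_def
proof (intro conjI ballI allI)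
  have "f 0 = 0" using scale[OF H.subspace_0[OF sub], of 0] by simp
  then show "0 \<in> f ` V" using H.subspace_0[OF sub] by force
next
  fix u v assume "u \<in> f ` V" "v \<in> f ` V"
  then obtain x y where xy: "x \<in> V" "y \<in> V" "u = f x" "v = f y" by blast
  then have "u + v = f (x + y)" using add by simp
  then show "u + v \<in> f ` V" using xy H.subspace_add[OF sub] by blast
next
  fix c u assume "u \<in> f ` V"
  then obtain x where x: "x \<in> V" "u = f x" by blast
  then have "hscale K c u = f (hscale H c x)" using scale by simp
  then show "hscale K c u \<in> f ` V" using x H.subspace_scale[OF sub] by blast
qed

text \<open>Linearity is demanded on \<open>V\<close> only, so that maps linear merely on a subspace
  qualify, such as an inverse of \<open>b\<close> built by choice, which is linear on the range of
  \<open>b\<close>.\<close>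

lemma dim_at_most_image:
  assumes V: "dim_at_most H V r"
    and add: "\<And>x y. x \<in> V \<Longrightarrow> y \<in> V \<Longrightarrow> f (x + y) = f x + f y"
    and scale: "\<And>c x. x \<in> V \<Longrightarrow> f (hscale H c x) = hscale K c (f x)"
  shows "dim_at_most K (f ` V) r"
proof -
  have sub: "H.subspace V" using V H.dim_at_most_iff by blast
  obtain F where F: "finite F" "H.span F = V" using V unfolding dim_at_most_def by blast
  obtain G where G: "G \<subseteq> V" "H.independent G" "V \<subseteq> H.span G" "card G = H.dim V"
    using H.basis_exists by blast
  have "finite G" using H.independent_span_bound[OF F(1) G(2)] F(2) G(1) by blast
  moreover have "card G \<le> r" using G(4) V by (simp add: dim_at_most_def)
  moreover have "card (f ` G) \<le> card G" using \<open>finite G\<close> by (rule card_image_le)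
  moreover have "f ` V \<subseteq> K.span (f ` G)"
  proof -
    have "f 0 = 0" using scale[OF H.subspace_0[OF sub], of 0] by simp
    then have "H.subspace {x \<in> V. f x \<in> K.span (f ` G)}"
      using sub by (auto simp: H.subspace_def add scale K.span_zero intro: K.span_add K.span_scale)
    moreover have "G \<subseteq> {x \<in> V. f x \<in> K.span (f ` G)}"
      using G(1) K.span_superset[of "f ` G"] by blast
    ultimately have "H.span G \<subseteq> {x \<in> V. f x \<in> K.span (f ` G)}" by (rule H.span_minimal[rotated])
    then show ?thesis using G(3) by blast
  qed
  moreover have "K.subspace (f ` V)" using sub add scale by (rule subspace_image)
  ultimately show ?thesis unfolding K.dim_at_most_iff
    by (meson finite_imageI order_trans)
qed

lemma subspace_range: "blin H K t \<Longrightarrow> K.subspace (range t)"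
  by (rule subspace_image) (simp_all add: blin_add blin_hscale)

lemma orth_range_adj:
  assumes t: "blin H K t"
  shows "orth H (range (adj t)) = {x. t x = 0}"
proof -
  have "(\<forall>y. hinner K (t x) y = 0) \<longleftrightarrow> t x = 0" for x
    using K.hinner_ext[of "t x" 0] K.hinner_eq_0_commute by auto
  then show ?thesis by (auto simp: orth_def simp flip: adj[OF t])
qed

lemma subspace_range_adj:
  assumes t: "blin H K t"
  shows "H.subspace (range (adj t))"
proof -
  interpret KH: hilbert_pair K H by unfold_locales
  have "adj t (x + y) = adj t x + adj t y" for x y
    by (rule H.hinner_ext) (simp add: K.hinner_add_right H.hinner_add_right flip: adj[OF t])
  moreover have "adj t (hscale K c x) = hscale H c (adj t x)" for c x
    by (rule H.hinner_ext) (simp add: K.hinner_hscale_right H.hinner_hscale_right flip: adj[OF t])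
  ultimately show ?thesis by (intro KH.subspace_image K.subspace_UNIV) auto
qed

text \<open>Take complements in \<open>orth_range_adj\<close>. This makes vectors orthogonal to the
  kernel limits of vectors \<open>adj t u\<close>, against which inner products can be moved through
  \<open>t\<close>.\<close>

lemma orth_kernel:
  assumes t: "blin H K t"
  shows "orth H {x. t x = 0} = closure (range (adj t))"
  using H.orth_orth_closure[OF subspace_range_adj[OF t]] orth_range_adj[OF t] by simp

text \<open>The discarded part lies in the double complement of the kernel, which is the kernel
  itself because the kernel is closed.\<close>

lemma apply_pr_orth_kernel:
  assumes t: "blin H K t"
  shows "t (H.pr (orth H {x. t x = 0}) x) = t x"
proof -
  let ?N = "{x. t x = 0}"
  interpret N: closed_subspace H ?N by (rule closed_subspace_kernel[OF t])
  interpret O: closed_subspace H "orth H ?N" by (rule H.closed_subspace_orth)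
  have "x - H.pr (orth H ?N) x \<in> ?N" using O.pr_orth N.orth_orth by blast
  then show ?thesis by (simp add: blin_diff[OF t])
qed

text \<open>A decomposition of \<open>y\<close> into a range vector and an orthogonal one must be
  the projection decomposition onto the closure of the range; the only question is whether the
  projected part lies in the range proper.\<close>

lemma dom_mp_inverse_iff:
  assumes t: "blin H K t"
  shows "y \<in> dom (mp_inverse H K (Some \<circ> t)) \<longleftrightarrow> K.pr (closure (range t)) y \<in> range t"
proof -
  interpret R: closed_subspace K "closure (range t)"
    by (rule K.closed_subspace_closure[OF subspace_range[OF t]])
  have ran: "ran (Some \<circ> t) = range t" by (auto simp: ran_def)
  have "y \<in> dom (mp_inverse H K (Some \<circ> t)) \<longleftrightarrow> (\<exists>h\<in>range t. \<exists>k\<in>orth K (range t). y = h + k)"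
    by (simp add: mp_inverse_def dom_def ran)
  also have "\<dots> \<longleftrightarrow> K.pr (closure (range t)) y \<in> range t"
  proof
    assume "\<exists>h\<in>range t. \<exists>k\<in>orth K (range t). y = h + k"
    then obtain h k where hk: "h \<in> range t" "k \<in> orth K (range t)" "y = h + k" by blast
    then have "K.pr (closure (range t)) y = h"
      using subsetD[OF closure_subset, of h "range t"] by (intro R.pr_unique) auto
    then show "K.pr (closure (range t)) y \<in> range t" using hk by simp
  next
    assume "K.pr (closure (range t)) y \<in> range t"
    moreover have "y - K.pr (closure (range t)) y \<in> orth K (range t)" using R.pr_orth by simp
    moreover have "y = K.pr (closure (range t)) y + (y - K.pr (closure (range t)) y)" by simp
    ultimately show "\<exists>h\<in>range t. \<exists>k\<in>orth K (range t). y = h + k" by blast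
  qed
  finally show ?thesis .
qed

lemma finite_rank_ops_iff:
  "T \<in> finite_rank_ops r H K \<longleftrightarrow> (\<exists>t. T = Some \<circ> t \<and> blin H K t \<and> dim_at_most K (range t) r)"
proof -
  have "ran (Some \<circ> t) = range t" for t :: "'a \<Rightarrow> 'b" by (auto simp: ran_def)
  then show ?thesis unfolding finite_rank_ops_def using bounded_ops_iff by auto
qed

lemma lin_op_zero: "lin_op H K T \<Longrightarrow> the (T 0) = 0"
  unfolding lin_op_def using H.subspace_0 H.scale_zero_left K.scale_zero_left by metis

lemma lin_op_blin: "blin H K t \<Longrightarrow> lin_op H K (Some \<circ> t)"
  using bounded_ops_iff bounded_ops_def by blast

end

lemma ran_conv_image: "ran T = (\<lambda>x. the (T x)) ` dom T"
  by (force simp: ran_def dom_def)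

section \<open>Solutions and best low-rank approximations\<close>

lemma Some_comp_map_comp: "(Some \<circ> t) \<circ>\<^sub>m (Some \<circ> u) = Some \<circ> (\<lambda>x. t (u x))"
  by (simp add: map_comp_def fun_eq_iff)

lemma Some_comp_op_diff: "(Some \<circ> t) -\<^sub>p (Some \<circ> u) = Some \<circ> (\<lambda>x. t x - u x)"
  by (auto simp: op_diff_def fun_eq_iff)

text \<open>The everywhere defined data are total functions from here on; only the unknown operators
  remain partial.\<close>

locale rank_problem =
  H1: hilbert_space H1 + H2: hilbert_space H2 + H3: hilbert_space H3 + H4: hilbert_space H4
  for H1 :: "('k::real_or_complex, 'a::banach) hspace" and H2 :: "('k, 'b::banach) hspace"
    and H3 :: "('k, 'c::banach) hspace" and H4 :: "('k, 'd::banach) hspace" +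
  fixes m :: "'a \<Rightarrow> 'd" and b :: "'c \<Rightarrow> 'd" and c :: "'a \<Rightarrow> 'b" and r :: nat
  assumes m: "hs H1 H4 m" and b: "blin H3 H4 b" and c: "blin H1 H2 c"
begin

sublocale H12: hilbert_pair H1 H2 ..
sublocale H14: hilbert_pair H1 H4 ..
sublocale H23: hilbert_pair H2 H3 ..
sublocale H34: hilbert_pair H3 H4 ..
sublocale H43: hilbert_pair H4 H3 ..

abbreviation "ranB \<equiv> closure (range b)"
abbreviation "ranC \<equiv> closure (range c)"
abbreviation "kerB \<equiv> {x. b x = 0}"
abbreviation "kerC \<equiv> {x. c x = 0}"
abbreviation "domC \<equiv> {y. H2.pr ranC y \<in> range c}"

sublocale RB: closed_subspace H4 ranB
  by (rule H4.closed_subspace_closure[OF H34.subspace_range[OF b]])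
sublocale RC: closed_subspace H2 ranC
  by (rule H2.closed_subspace_closure[OF H12.subspace_range[OF c]])
sublocale RCo: closed_subspace H2 "orth H2 (range c)"
  by (rule H2.closed_subspace_orth)
sublocale KB: closed_subspace H3 kerB
  by (rule H34.closed_subspace_kernel[OF b])
sublocale KBo: closed_subspace H3 "orth H3 kerB"
  by (rule H3.closed_subspace_orth)
sublocale KC: closed_subspace H1 kerC
  by (rule H12.closed_subspace_kernel[OF c])
sublocale KCo: closed_subspace H1 "orth H1 kerC"
  by (rule H1.closed_subspace_orth)

definition k :: "'a \<Rightarrow> 'd" where
  "k x = H4.pr ranB (m (H1.pr (orth H1 kerC) x))"

text \<open>Extracting with \<open>the\<close> is safe for admissible \<open>X\<close>, since the
  range of \<open>c\<close> lies in \<open>domC\<close> and hence in the domain of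
  \<open>X\<close>.\<close>

definition bxc :: "('b \<rightharpoonup> 'c) \<Rightarrow> 'a \<Rightarrow> 'd" where
  "bxc X x = b (the (X (c x)))"

abbreviation "Xs \<equiv> X_set H1 H2 H3 H4 (Some \<circ> b) (Some \<circ> c) r"
abbreviation "Ys \<equiv> Y_set H1 H3 H4 (Some \<circ> m) (Some \<circ> b) (Some \<circ> c) r"
abbreviation "Ss \<equiv> S_set H1 H2 H3 H4 (Some \<circ> m) (Some \<circ> b) (Some \<circ> c) r"
abbreviation "Sstar \<equiv> S_star_set H1 H2 H3 H4 (Some \<circ> m) (Some \<circ> b) (Some \<circ> c) r"

section \<open>Reformulation of the solution sets in terms of B X C and K\<close>

lemma dom_mp_inverse_C: "dom (mp_inverse H1 H2 (Some \<circ> c)) = domC"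
  using H12.dom_mp_inverse_iff[OF c] by blast

lemma range_b_in: "b x \<in> ranB"
  by (rule subsetD[OF closure_subset]) simp

lemma range_c_in: "c x \<in> ranC"
  by (rule subsetD[OF closure_subset]) simp

lemma range_c_domC: "range c \<subseteq> domC"
  using range_c_in by auto

lemma map_comp_bxc:
  assumes "range c \<subseteq> dom X"
  shows "(Some \<circ> b) \<circ>\<^sub>m X \<circ>\<^sub>m (Some \<circ> c) = Some \<circ> bxc X"
proof
  fix x
  have "c x \<in> dom X" using assms by blast
  then show "((Some \<circ> b) \<circ>\<^sub>m X \<circ>\<^sub>m (Some \<circ> c)) x = (Some \<circ> bxc X) x"
    by (auto simp: map_comp_def bxc_def)
qed

lemma X_set_iff:
  "X \<in> Xs \<longleftrightarrow> lin_op H2 H3 X \<and> domC \<subseteq> dom X \<and> dim_at_most H3 (ran X) r \<and> hs H1 H4 (bxc X)"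
proof (cases "domC \<subseteq> dom X")
  case True
  have "((Some :: 'd \<Rightarrow> 'd option) \<circ> t = Some \<circ> u) \<longleftrightarrow> t = u" for t u :: "'a \<Rightarrow> 'd"
    by (auto simp: fun_eq_iff)
  then have "(Some \<circ> b) \<circ>\<^sub>m X \<circ>\<^sub>m (Some \<circ> c) \<in> hs_ops H1 H4 \<longleftrightarrow> hs H1 H4 (bxc X)"
    using map_comp_bxc[of X] True range_c_domC H14.hs_ops_iff by auto
  then show ?thesis by (simp add: X_set_def dom_mp_inverse_C)
next
  case False
  then show ?thesis by (simp add: X_set_def dom_mp_inverse_C)
qed

lemma K_op_eq: "K_op H1 H4 (Some \<circ> m) (Some \<circ> b) (Some \<circ> c) = Some \<circ> k"
proof -
  have "ran (Some \<circ> b) = range b" "ker (Some \<circ> c) = kerC" by (auto simp: ran_def ker_def)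
  then show ?thesis
    by (simp add: K_op_def H1.proj_eq H4.proj_eq Some_comp_map_comp k_def[abs_def])
qed

lemma hs_k: "hs H1 H4 k"
  unfolding k_def[abs_def]
  by (rule H14.hs_split(1)[OF m KCo.closed_subspace_axioms RB.closed_subspace_axioms])

lemma pythagoras_compression:
  assumes t: "hs H1 H4 t"
  shows "hsq H1 (\<lambda>x. H4.pr ranB (t (H1.pr (orth H1 kerC) x))) \<le> hsq H1 t"
    and "hsq H1 t = hsq H1 (\<lambda>x. H4.pr ranB (t (H1.pr (orth H1 kerC) x)))
      + hsq H1 (\<lambda>x. t x - H4.pr ranB (t (H1.pr (orth H1 kerC) x)))"
proof -
  show "hsq H1 t = hsq H1 (\<lambda>x. H4.pr ranB (t (H1.pr (orth H1 kerC) x)))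
      + hsq H1 (\<lambda>x. t x - H4.pr ranB (t (H1.pr (orth H1 kerC) x)))"
    by (rule H14.hs_split(2)[OF t KCo.closed_subspace_axioms RB.closed_subspace_axioms])
  then show "hsq H1 (\<lambda>x. H4.pr ranB (t (H1.pr (orth H1 kerC) x))) \<le> hsq H1 t"
    using hsq_nonneg[of H1 "\<lambda>x. t x - H4.pr ranB (t (H1.pr (orth H1 kerC) x))"] by linarith
qed

lemma bxc_compression: "H4.pr ranB (bxc X (H1.pr (orth H1 kerC) x)) = bxc X x"
  using range_b_in by (simp add: bxc_def H12.apply_pr_orth_kernel[OF c])

lemma hsq_residual:
  assumes X: "hs H1 H4 (bxc X)"
  shows "hsq H1 (\<lambda>x. m x - bxc X x) = hsq H1 (\<lambda>x. k x - bxc X x) + hsq H1 (\<lambda>x. m x - k x)"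
proof -
  have "H4.pr ranB (m (H1.pr (orth H1 kerC) x) - bxc X (H1.pr (orth H1 kerC) x)) = k x - bxc X x" for x
    using blin_diff[OF RB.blin_pr] bxc_compression by (simp add: k_def)
  then show ?thesis
    using pythagoras_compression(2)[OF H14.hs_minus[OF m X]] by simp
qed

lemma S_set_iff:
  "X \<in> Ss \<longleftrightarrow> X \<in> Xs \<and> (\<forall>X'\<in>Xs. hsq H1 (\<lambda>x. k x - bxc X x) \<le> hsq H1 (\<lambda>x. k x - bxc X' x))"
proof -
  have "hs_norm H1 ((Some \<circ> m) -\<^sub>p ((Some \<circ> b) \<circ>\<^sub>m X \<circ>\<^sub>m (Some \<circ> c)))
      = sqrt (hsq H1 (\<lambda>x. k x - bxc X x) + hsq H1 (\<lambda>x. m x - k x))" if "X \<in> Xs" for X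
  proof -
    have "range c \<subseteq> dom X" using that range_c_domC X_set_iff by blast
    then show ?thesis
      using that hsq_residual X_set_iff
      by (simp add: map_comp_bxc Some_comp_op_diff hs_norm_Some)
  qed
  then show ?thesis unfolding S_set_def by auto
qed

lemma Y_set_iff:
  "Some \<circ> y \<in> Ys \<longleftrightarrow> blin H1 H4 y \<and> dim_at_most H4 (range y) r \<and>
     range y \<subseteq> dom (mp_inverse H3 H4 (Some \<circ> b)) \<and>
     (\<forall>y'. blin H1 H4 y' \<longrightarrow> dim_at_most H4 (range y') r \<longrightarrow>
        hsq H1 (\<lambda>x. k x - y x) \<le> hsq H1 (\<lambda>x. k x - y' x))"
proof -
  have "Some \<circ> t \<in> finite_rank_ops r H1 H4 \<longleftrightarrow> blin H1 H4 t \<and> dim_at_most H4 (range t) r" for t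
    unfolding H14.finite_rank_ops_iff by (auto simp: fun_eq_iff) (metis ext)+
  moreover have "T \<in> finite_rank_ops r H1 H4 \<Longrightarrow> \<exists>t. T = Some \<circ> t" for T
    unfolding H14.finite_rank_ops_iff by blast
  moreover have "ran (Some \<circ> y) = range y" by (auto simp: ran_def)
  ultimately show ?thesis
    unfolding Y_set_def K_op_eq by (force simp: Some_comp_op_diff hs_norm_Some)
qed

lemma Y_setE:
  assumes "Y \<in> Ys" obtains y where "Y = Some \<circ> y"
  using assms H14.finite_rank_ops_iff unfolding Y_set_def by blast

section \<open>From a solution to a best approximation\<close>

lemma dim_range_bxc:
  assumes X: "X \<in> Xs"
  shows "dim_at_most H4 (range (bxc X)) r"
proof (rule H4.dim_at_most_mono)
  have "dim_at_most H3 (ran X) r" using X X_set_iff by blast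
  then show "dim_at_most H4 (b ` ran X) r"
    by (rule H34.dim_at_most_image) (simp_all add: blin_add[OF b] blin_hscale[OF b])
  show "H4.subspace (range (bxc X))"
    using X X_set_iff H14.subspace_range H14.hs_blin by blast
  have "c x \<in> dom X" for x using X range_c_domC X_set_iff by blast
  then show "range (bxc X) \<subseteq> b ` ran X"
    unfolding ran_conv_image bxc_def[abs_def] by blast
qed

lemma dim_range_finite_sum:
  assumes t: "blin H2 H3 (\<lambda>x. \<Sum>v\<in>I. hscale H3 (f v x) (d v))" and I: "finite I" "card I \<le> r"
  shows "dim_at_most H3 (range (\<lambda>x. \<Sum>v\<in>I. hscale H3 (f v x) (d v))) r"
  unfolding H3.dim_at_most_iff
proof (intro conjI exI)
  show "H3.subspace (range (\<lambda>x. \<Sum>v\<in>I. hscale H3 (f v x) (d v)))"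
    using t by (rule H23.subspace_range)
  show "finite (d ` I)" using I by simp
  show "card (d ` I) \<le> r" using I card_image_le order_trans by blast
  have "(\<Sum>v\<in>I. hscale H3 (f v x) (d v)) \<in> H3.span (d ` I)" for x
    by (intro H3.span_sum H3.span_scale H3.span_base imageI)
  then show "range (\<lambda>x. \<Sum>v\<in>I. hscale H3 (f v x) (d v)) \<subseteq> H3.span (d ` I)" by blast
qed

text \<open>
  The vectors defining the compression of \<open>y\<close> lie in the closures of the ranges of the adjoint of
  \<open>c\<close> and of \<open>b\<close>; approximating them by vectors in these ranges approximates the compression by
  operators of the form \<open>B X C\<close>.
\<close>

lemma S_set_le_finite_rank:
  assumes X: "X \<in> Ss" and y: "blin H1 H4 y" and r: "dim_at_most H4 (range y) r"
  shows "hsq H1 (\<lambda>x. k x - bxc X x) \<le> hsq H1 (\<lambda>x. k x - y x)"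
proof -
  obtain I a where I: "finite I" "card I \<le> r"
    and ya: "y = (\<lambda>x. \<Sum>v\<in>I. hscale H4 (hinner H1 x (a v)) v)"
    by (rule H14.finite_rank_decomposition[OF y r])
  have hs_y: "hs H1 H4 y" unfolding ya by (rule H14.hs_finite_rank)
  define p where "p v = H1.pr (orth H1 kerC) (a v)" for v
  define q where "q v = H4.pr ranB v" for v
  define z where "z x = (\<Sum>v\<in>I. hscale H4 (hinner H1 x (p v)) (q v))" for x
  have hs_z: "hs H1 H4 z" unfolding z_def[abs_def] by (rule H14.hs_finite_rank)
  have "H4.pr ranB (sum g I) = (\<Sum>v\<in>I. H4.pr ranB (g v))" for g
    using blin_bounded_linear[OF RB.blin_pr] by (simp add: bounded_linear.linear linear_sum)
  then have "H4.pr ranB (y (H1.pr (orth H1 kerC) x)) = z x" for x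
    by (simp add: ya z_def p_def q_def blin_hscale[OF RB.blin_pr] KCo.hinner_pr)
  moreover have "H4.pr ranB (k (H1.pr (orth H1 kerC) x)) = k x" for x
    by (simp add: k_def RB.pr_in KCo.pr_in)
  \<comment> \<open>Since \<open>k\<close> is its own compression and \<open>z\<close> is that of
    \<open>y\<close>, compressing \<open>k - y\<close> gives \<open>k - z\<close>, and compression
    does not increase the norm.\<close>
  ultimately have "hsq H1 (\<lambda>x. k x - z x) \<le> hsq H1 (\<lambda>x. k x - y x)"
    using pythagoras_compression(1)[OF H14.hs_minus[OF hs_k hs_y]]
    by (simp add: blin_diff[OF RB.blin_pr])
  moreover have "sqrt (hsq H1 (\<lambda>x. k x - bxc X x)) \<le> sqrt (hsq H1 (\<lambda>x. k x - z x))"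
  proof -
    have "p v \<in> closure (range (H12.adj c))" for v
      using KCo.pr_in H12.orth_kernel[OF c] p_def by simp
    then have "\<exists>g. (\<forall>n::nat. g n \<in> range (H12.adj c)) \<and> g \<longlonglongrightarrow> p v" for v
      unfolding closure_sequential by blast
    then obtain g where g: "\<And>v n::nat. g v n \<in> range (H12.adj c)" "\<And>v. g v \<longlonglongrightarrow> p v" by metis
    then have "\<forall>v n. \<exists>u. g v n = H12.adj c u" by (metis rangeE)
    then obtain \<gamma> where \<gamma>: "\<And>v n. g v n = H12.adj c (\<gamma> v n)" by metis
    have "q v \<in> closure (range b)" for v using RB.pr_in q_def by simp
    then have "\<exists>h. (\<forall>n::nat. h n \<in> range b) \<and> h \<longlonglongrightarrow> q v" for v
      unfolding closure_sequential by blast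
    then obtain h where h: "\<And>v n::nat. h v n \<in> range b" "\<And>v. h v \<longlonglongrightarrow> q v" by metis
    then have "\<forall>v n. \<exists>u. h v n = b u" by (metis rangeE)
    then obtain \<delta> where \<delta>: "\<And>v n. h v n = b (\<delta> v n)" by metis
    \<comment> \<open>Moving \<open>c\<close> to the adjoint and applying \<open>b\<close> to the
      vectors \<delta> turns \<open>bxc (Some \<circ> s n)\<close> into the operator with the
      approximating vectors \<open>g v n\<close> and \<open>h v n\<close> in place of
      \<open>p v\<close> and \<open>q v\<close>.\<close>
    define s where "s n x = (\<Sum>v\<in>I. hscale H3 (hinner H2 x (\<gamma> v n)) (\<delta> v n))" for n x
    have hs_s: "hs H2 H3 (s n)" for n unfolding s_def[abs_def] by (rule H23.hs_finite_rank)
    have b_sum: "b (sum f I) = (\<Sum>v\<in>I. b (f v))" for f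
      using blin_bounded_linear[OF b] by (simp add: bounded_linear.linear linear_sum)
    have bxc_s: "bxc (Some \<circ> s n) = (\<lambda>x. \<Sum>v\<in>I. hscale H4 (hinner H1 x (g v n)) (h v n))" for n
      by (simp add: bxc_def s_def b_sum blin_hscale[OF b] H12.adj[OF c] \<gamma> \<delta> fun_eq_iff)
    have hs_bxc: "hs H1 H4 (bxc (Some \<circ> s n))" for n
      unfolding bxc_s by (rule H14.hs_finite_rank)
    have s_in: "Some \<circ> s n \<in> Xs" for n
    proof -
      have bl: "blin H2 H3 (s n)" using hs_s H23.hs_blin by blast
      have "ran (Some \<circ> s n) = range (s n)" "dom (Some \<circ> s n) = UNIV" by (auto simp: ran_def)
      moreover have "dim_at_most H3 (range (s n)) r"
        using dim_range_finite_sum[where I = I and f = "\<lambda>v x. hinner H2 x (\<gamma> v n)"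
            and d = "\<lambda>v. \<delta> v n"] I bl
        unfolding s_def[abs_def] by blast
      ultimately show ?thesis
        unfolding X_set_iff using H23.lin_op_blin[OF bl] hs_bxc by simp
    qed
    \<comment> \<open>The bound from \<open>hs_finite_rank_diff\<close>; it tends to 0 because
      \<open>I\<close> is finite and the norms of \<open>g v n\<close> converge.\<close>
    define \<epsilon> where "\<epsilon> n = (\<Sum>v\<in>I. norm (p v - g v n) * norm (q v) + norm (g v n) * norm (q v - h v n))" for n
    have "sqrt (hsq H1 (\<lambda>x. k x - bxc X x)) \<le> sqrt (hsq H1 (\<lambda>x. k x - z x)) + \<epsilon> n" for n
    proof -
      have "sqrt (hsq H1 (\<lambda>x. k x - bxc X x)) \<le> sqrt (hsq H1 (\<lambda>x. k x - bxc (Some \<circ> s n) x))"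
        using X s_in S_set_iff by simp
      also have "\<dots> = sqrt (hsq H1 (\<lambda>x. (k x - z x) + (z x - bxc (Some \<circ> s n) x)))"
        by simp
      also have "\<dots> \<le> sqrt (hsq H1 (\<lambda>x. k x - z x)) + sqrt (hsq H1 (\<lambda>x. z x - bxc (Some \<circ> s n) x))"
        by (intro H14.hs_plus[THEN conjunct2] H14.hs_minus hs_k hs_z hs_bxc)
      also have "sqrt (hsq H1 (\<lambda>x. z x - bxc (Some \<circ> s n) x)) \<le> \<epsilon> n"
        unfolding bxc_s z_def \<epsilon>_def by (rule H14.hs_finite_rank_diff)
      finally show ?thesis by simp
    qed
    moreover have "(\<lambda>n. sqrt (hsq H1 (\<lambda>x. k x - z x)) + \<epsilon> n) \<longlonglongrightarrow>
      sqrt (hsq H1 (\<lambda>x. k x - z x))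
      + (\<Sum>v\<in>I. norm (p v - p v) * norm (q v) + norm (p v) * norm (q v - q v))"
      unfolding \<epsilon>_def by (intro tendsto_intros g h)
    then have "(\<lambda>n. sqrt (hsq H1 (\<lambda>x. k x - z x)) + \<epsilon> n) \<longlonglongrightarrow> sqrt (hsq H1 (\<lambda>x. k x - z x))"
      by simp
    ultimately show ?thesis by (intro LIMSEQ_le_const) auto
  qed
  ultimately show ?thesis by simp
qed

lemma Some_bxc_in_Y_set:
  assumes X: "X \<in> Ss"
  shows "Some \<circ> bxc X \<in> Ys"
  unfolding Y_set_iff
proof (intro conjI allI impI)
  have X': "X \<in> Xs" using X S_set_iff by blast
  show "blin H1 H4 (bxc X)" using X' X_set_iff H14.hs_blin by blast
  show "dim_at_most H4 (range (bxc X)) r" using X' by (rule dim_range_bxc)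
  have "bxc X x \<in> dom (mp_inverse H3 H4 (Some \<circ> b))" for x
    unfolding H34.dom_mp_inverse_iff[OF b] bxc_def using range_b_in by simp
  then show "range (bxc X) \<subseteq> dom (mp_inverse H3 H4 (Some \<circ> b))" by blast
qed (use S_set_le_finite_rank[OF X] in blast)

section \<open>From a best approximation to a solution\<close>

text \<open>Optimality forces \<open>y\<close> to coincide with its own compression.\<close>

lemma Y_set_compression:
  assumes Y: "Some \<circ> y \<in> Ys"
  shows "H4.pr ranB (y (H1.pr (orth H1 kerC) x)) = y x"
proof -
  let ?z = "\<lambda>x. H4.pr ranB (y (H1.pr (orth H1 kerC) x))"
  have y: "blin H1 H4 y" "dim_at_most H4 (range y) r" using Y Y_set_iff by auto
  obtain I a where I: "finite I"  "card I \<le> r"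
    and ya: "y = (\<lambda>x. \<Sum>v\<in>I. hscale H4 (hinner H1 x (a v)) v)"
    by (rule H14.finite_rank_decomposition[OF y])
  have hs_y: "hs H1 H4 y" unfolding ya by (rule H14.hs_finite_rank)
  have hs_z: "hs H1 H4 ?z"
    by (rule H14.hs_split(1)[OF hs_y KCo.closed_subspace_axioms RB.closed_subspace_axioms])
  have "dim_at_most H4 (H4.pr ranB ` range y) r"
  proof -
    interpret H44: hilbert_pair H4 H4 ..
    show ?thesis using y(2)
      by (rule H44.dim_at_most_image) (simp_all add: RB.pr_add RB.pr_hscale)
  qed
  then have "dim_at_most H4 (range ?z) r"
    by (rule H4.dim_at_most_mono) (use H14.subspace_range[OF H14.hs_blin[OF hs_z]] in auto)
  \<comment> \<open>Compression does not raise the rank, so \<open>?z\<close> is itself a competitor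
    of \<open>y\<close>. Pythagoras then leaves no room for a nonzero \<open>?z - y\<close>.\<close>
  then have "hsq H1 (\<lambda>x. k x - y x) \<le> hsq H1 (\<lambda>x. k x - ?z x)"
    using Y Y_set_iff H14.hs_blin[OF hs_z] by blast
  moreover have "H4.pr ranB (k (H1.pr (orth H1 kerC) x)) = k x" for x
    by (simp add: k_def RB.pr_in KCo.pr_in)
  then have "hsq H1 (\<lambda>x. k x - y x) = hsq H1 (\<lambda>x. k x - ?z x) + hsq H1 (\<lambda>x. ?z x - y x)"
    using pythagoras_compression(2)[OF H14.hs_minus[OF hs_k hs_y]]
    by (simp add: blin_diff[OF RB.blin_pr])
  ultimately have "hsq H1 (\<lambda>x. ?z x - y x) = 0"
    using hsq_nonneg[of H1 "\<lambda>x. ?z x - y x"] by linarith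
  then have "?z x - y x = 0" by (rule H14.hs_eq_0[OF H14.hs_minus[OF hs_z hs_y]])
  then show ?thesis by simp
qed

text \<open>The compression identity puts the values in the closure of the range of
  \<open>b\<close>, where the projector acts as the identity; the domain condition of
  \<open>Y_set\<close> then says that they lie in the range itself.\<close>

lemma Y_set_range:
  assumes Y: "Some \<circ> y \<in> Ys"
  shows "range y \<subseteq> range b"
proof -
  have "y x \<in> range b" for x
  proof -
    have "y x \<in> ranB" using RB.pr_in Y_set_compression[OF Y] by metis
    moreover have "y x \<in> dom (mp_inverse H3 H4 (Some \<circ> b))" using Y Y_set_iff by blast
    ultimately show ?thesis unfolding H34.dom_mp_inverse_iff[OF b] by simp
  qed
  then show ?thesis by blast
qed

lemma Y_set_cong:
  assumes Y: "Some \<circ> y \<in> Ys" and "c u = c v"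
  shows "y u = y v"
proof -
  have "u - v \<in> kerC" using assms(2) by (simp add: blin_diff[OF c])
  then have "u - v \<in> orth H1 (orth H1 kerC)" using KC.orth_orth by simp
  then have "H1.pr (orth H1 kerC) (u - v) = 0" by (rule KCo.pr_of_orth)
  moreover have bl: "blin H1 H4 y" using Y Y_set_iff by blast
  ultimately have "y (u - v) = 0"
    using Y_set_compression[OF Y, of "u - v"] blin_zero[OF bl] blin_zero[OF RB.blin_pr] by simp
  then show ?thesis by (simp add: blin_diff[OF bl])
qed

text \<open>
  The witness is \<open>B\<^sup>\<dagger> Y C\<^sup>\<dagger>\<close>.  Since \<open>y\<close> is constant on the fibres of \<open>c\<close>, an arbitrary choice \<open>\<gamma>\<close> of
  preimages can replace \<open>C\<^sup>\<dagger>\<close>.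
\<close>

lemma Y_set_factor:
  assumes Y: "Some \<circ> y \<in> Ys"
  obtains X where "X \<in> Xs" "bxc X = y"
proof -
  have bl: "blin H1 H4 y" and r: "dim_at_most H4 (range y) r" using Y Y_set_iff by auto
  \<comment> \<open>The Moore-Penrose inverse of B on its range: projecting an arbitrary preimage
    away from the kernel removes the dependence on the choice, and this makes \<beta> linear
    there.\<close>
  define \<beta> where "\<beta> w = H3.pr (orth H3 kerB) (SOME u. b u = w)" for w
  define \<gamma> where "\<gamma> v = (SOME x. c x = H2.pr ranC v)" for v
  define X where "X v = (if v \<in> domC then Some (\<beta> (y (\<gamma> v))) else None)" for v
  have \<beta>_b: "\<beta> (b u) = H3.pr (orth H3 kerB) u" for u
  proof -
    have "b (SOME u'. b u' = b u) = b u" by (rule someI) simp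
    then have "(SOME u'. b u' = b u) - u \<in> orth H3 (orth H3 kerB)"
      using KB.orth_orth by (simp add: blin_diff[OF b])
    then have "H3.pr (orth H3 kerB) ((SOME u'. b u' = b u) - u) = 0" by (rule KBo.pr_of_orth)
    then show ?thesis by (simp add: \<beta>_def blin_diff[OF KBo.blin_pr])
  qed
  have b\<beta>: "b (\<beta> w) = w" if "w \<in> range b" for w
    using that \<beta>_b H34.apply_pr_orth_kernel[OF b] by auto
  have \<beta>_add: "\<beta> (w + w') = \<beta> w + \<beta> w'" if ww: "w \<in> range b" "w' \<in> range b" for w w'
  proof -
    obtain u u' where "w = b u" "w' = b u'" using ww by blast
    then show ?thesis using \<beta>_b[of "u + u'"] \<beta>_b by (simp add: blin_add[OF b] KBo.pr_add)
  qed
  have \<beta>_scale: "\<beta> (hscale H4 s w) = hscale H3 s (\<beta> w)" if ww: "w \<in> range b" for w s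
  proof -
    obtain u where "w = b u" using ww by blast
    then show ?thesis using \<beta>_b[of "hscale H3 s u"] \<beta>_b by (simp add: blin_hscale[OF b] KBo.pr_hscale)
  qed
  have c\<gamma>: "c (\<gamma> v) = H2.pr ranC v" if v: "v \<in> domC" for v
  proof -
    have "\<exists>x. c x = H2.pr ranC v" using v by force
    then show ?thesis unfolding \<gamma>_def by (rule someI_ex)
  qed
  have y\<gamma>: "y (\<gamma> v) = y x" if "v \<in> domC" "c x = H2.pr ranC v" for v x
    using Y_set_cong[OF Y, of "\<gamma> v" x] c\<gamma> that by simp
  have yb: "y x \<in> range b" for x using Y_set_range[OF Y] by blast
  have domX: "dom X = domC" by (auto simp: X_def dom_def)
  have add: "v + w \<in> domC" "y (\<gamma> (v + w)) = y (\<gamma> v) + y (\<gamma> w)" if vw: "v \<in> domC" "w \<in> domC" for v w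
  proof -
    \<comment> \<open>The choice \<gamma> need not be additive, but
      \<open>\<gamma> v + \<gamma> w\<close> is also a preimage of the projected sum, and
      \<open>y\<close> cannot distinguish preimages.\<close>
    have eq: "c (\<gamma> v + \<gamma> w) = H2.pr ranC (v + w)"
      using c\<gamma> vw by (simp add: blin_add[OF c] RC.pr_add)
    then show d: "v + w \<in> domC" by (metis mem_Collect_eq rangeI)
    show "y (\<gamma> (v + w)) = y (\<gamma> v) + y (\<gamma> w)" using y\<gamma>[OF d eq] by (simp add: blin_add[OF bl])
  qed
  have scale: "hscale H2 s v \<in> domC" "y (\<gamma> (hscale H2 s v)) = hscale H4 s (y (\<gamma> v))"
    if v: "v \<in> domC" for s v
  proof -
    have eq: "c (hscale H1 s (\<gamma> v)) = H2.pr ranC (hscale H2 s v)"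
      using c\<gamma> v by (simp add: blin_hscale[OF c] RC.pr_hscale)
    then show d: "hscale H2 s v \<in> domC" by (metis mem_Collect_eq rangeI)
    show "y (\<gamma> (hscale H2 s v)) = hscale H4 s (y (\<gamma> v))"
      using y\<gamma>[OF d eq] by (simp add: blin_hscale[OF bl])
  qed
  have "c 0 \<in> domC" using range_c_domC by blast
  then have sub: "H2.subspace domC"
    unfolding H2.subspace_def using add(1) scale(1) blin_zero[OF c] by simp
  have X_eq: "the (X v) = \<beta> (y (\<gamma> v))" if "v \<in> domC" for v using that by (simp add: X_def)
  have lin: "lin_op H2 H3 X"
    unfolding lin_op_def domX
  proof (intro conjI ballI allI)
    show "the (X (v + w)) = the (X v) + the (X w)" if "v \<in> domC" "w \<in> domC" for v w
      unfolding X_eq[OF that(1)] X_eq[OF that(2)] X_eq[OF add(1)[OF that]] add(2)[OF that]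
      using \<beta>_add yb by blast
    show "the (X (hscale H2 s v)) = hscale H3 s (the (X v))" if "v \<in> domC" for s v
      unfolding X_eq[OF that] X_eq[OF scale(1)[OF that]] scale(2)[OF that]
      using \<beta>_scale yb by blast
  qed (rule sub)
  have bxc: "bxc X = y"
  proof
    fix x
    have cx: "c x \<in> domC" "c x = H2.pr ranC (c x)" using range_c_domC range_c_in by auto
    show "bxc X x = y x"
      unfolding bxc_def X_eq[OF cx(1)] b\<beta>[OF yb] by (rule y\<gamma>[OF cx])
  qed
  have "dim_at_most H3 (\<beta> ` range y) r"
    using r by (rule H43.dim_at_most_image) (use \<beta>_add \<beta>_scale yb in auto)
  moreover have "H3.subspace (ran X)"
    unfolding ran_conv_image domX using sub lin unfolding lin_op_def domX
    by (intro H23.subspace_image) auto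
  moreover have "ran X \<subseteq> \<beta> ` range y"
    unfolding ran_conv_image domX using X_eq by auto
  ultimately have "dim_at_most H3 (ran X) r" by (rule H3.dim_at_most_mono)
  moreover obtain I a where "y = (\<lambda>x. \<Sum>v\<in>I. hscale H4 (hinner H1 x (a v)) v)"
    using H14.finite_rank_decomposition[OF bl r] by metis
  then have "hs H1 H4 y" using H14.hs_finite_rank by simp
  ultimately have "X \<in> Xs" unfolding X_set_iff bxc domX using lin by simp
  then show thesis using bxc that by blast
qed

theorem S_set_nonempty_iff: "Ss \<noteq> {} \<longleftrightarrow> Ys \<noteq> {}"
proof
  show "Ss \<noteq> {} \<Longrightarrow> Ys \<noteq> {}" using Some_bxc_in_Y_set by blast
next
  assume "Ys \<noteq> {}"
  then obtain y where Y: "Some \<circ> y \<in> Ys" using Y_setE by (metis ex_in_conv)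
  obtain X where X: "X \<in> Xs" "bxc X = y" using Y_set_factor[OF Y] .
  \<comment> \<open>Every admissible \<open>X'\<close> gives a bounded \<open>bxc X'\<close> of rank
    at most \<open>r\<close>, against which \<open>y\<close> is already optimal.\<close>
  have "hsq H1 (\<lambda>x. k x - bxc X x) \<le> hsq H1 (\<lambda>x. k x - bxc X' x)" if "X' \<in> Xs" for X'
  proof -
    have "blin H1 H4 (bxc X')" using that X_set_iff H14.hs_blin by blast
    then show ?thesis using Y dim_range_bxc[OF that] unfolding Y_set_iff X(2) by blast
  qed
  then have "X \<in> Ss" using X S_set_iff by blast
  then show "Ss \<noteq> {}" by blast
qed

end

section \<open>The structure of the solution set\<close>

lemma Some_comp_map_comp_left: "((Some \<circ> t) \<circ>\<^sub>m X) x = map_option t (X x)"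
  by (cases "X x") (simp_all add: map_comp_def)

lemma map_comp_Some_comp: "(X \<circ>\<^sub>m (Some \<circ> t)) x = X (t x)"
  by (simp add: map_comp_def)

lemma dom_op_add: "dom (T +\<^sub>p S) = dom T \<inter> dom S"
  by (auto simp: op_add_def dom_def)

lemma the_op_add: "x \<in> dom T \<Longrightarrow> x \<in> dom S \<Longrightarrow> the ((T +\<^sub>p S) x) = the (T x) + the (S x)"
  by (simp add: op_add_def)

lemma lin_op_add:
  "lin_op H K T \<Longrightarrow> x \<in> dom T \<Longrightarrow> y \<in> dom T \<Longrightarrow> the (T (x + y)) = the (T x) + the (T y)"
  by (simp add: lin_op_def)

lemma lin_op_hscale:
  "lin_op H K T \<Longrightarrow> x \<in> dom T \<Longrightarrow> the (T (hscale H c x)) = hscale K c (the (T x))"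
  by (simp add: lin_op_def)

context rank_problem
begin

abbreviation op_sum :: "('b \<rightharpoonup> 'c) \<Rightarrow> ('b \<rightharpoonup> 'c) \<Rightarrow> ('b \<rightharpoonup> 'c) \<Rightarrow> 'b \<rightharpoonup> 'c" where
  "op_sum X T S \<equiv> X +\<^sub>p ((Some \<circ> H3.pr kerB) \<circ>\<^sub>m T) +\<^sub>p (S \<circ>\<^sub>m (Some \<circ> H2.pr (orth H2 (range c))))"

lemma pr_orth_range_c: "H2.pr (orth H2 (range c)) x = x - H2.pr ranC x"
  using RC.pr_orth_complement by simp

lemma S_star_set_iff:
  "X \<in> Sstar \<longleftrightarrow> X \<in> Ss \<and>
    (\<forall>x\<in>dom X. X x = map_option (H3.pr (orth H3 kerB)) (X (H2.pr ranC x)))"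
proof -
  have "ran (Some \<circ> c) = range c" "ker (Some \<circ> b) = kerB" by (auto simp: ran_def ker_def)
  then show ?thesis
    by (simp add: S_star_set_def H2.proj_eq H3.proj_eq Some_comp_map_comp_left map_comp_Some_comp)
qed

text \<open>Both the objective and the Hilbert-Schmidt condition depend on the operator only through
  \<open>bxc\<close>. Both inclusions of the structure formula rest on this.\<close>

lemma S_set_transfer:
  assumes X: "X \<in> Ss" and X': "lin_op H2 H3 X'" "domC \<subseteq> dom X'" "dim_at_most H3 (ran X') r"
    and eq: "bxc X' = bxc X"
  shows "X' \<in> Ss"
proof -
  have "X \<in> Xs" using X S_set_iff by blast
  then have "X' \<in> Xs" using X' unfolding X_set_iff eq by blast
  then show ?thesis using X unfolding S_set_iff eq by blast
qed

text \<open>The projection always lands in the domain of \<open>S\<close>, so the last summand is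
  defined everywhere, and \<open>T\<close> cuts a possibly larger domain of \<open>X\<close> down to
  \<open>domC\<close>.\<close>

lemma dom_op_sum:
  assumes "domC \<subseteq> dom X" "dom T = domC" "dom S = orth H2 (range c)"
  shows "dom (op_sum X T S) = domC"
proof -
  have "dom ((Some \<circ> H3.pr kerB) \<circ>\<^sub>m T) = dom T"
    unfolding dom_def Some_comp_map_comp_left by simp
  moreover have "dom (S \<circ>\<^sub>m (Some \<circ> H2.pr (orth H2 (range c)))) = UNIV"
    using RCo.pr_in assms(3) unfolding dom_def map_comp_Some_comp by blast
  ultimately show ?thesis using assms unfolding dom_op_add by blast
qed

lemma the_op_sum:
  assumes "domC \<subseteq> dom X" "dom T = domC" "dom S = orth H2 (range c)" "x \<in> domC"
  shows "the (op_sum X T S x)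
    = the (X x) + H3.pr kerB (the (T x)) + the (S (H2.pr (orth H2 (range c)) x))"
proof -
  have x: "x \<in> dom X" "x \<in> dom T" using assms by auto
  have T: "x \<in> dom ((Some \<circ> H3.pr kerB) \<circ>\<^sub>m T)"
    using x(2) unfolding dom_def Some_comp_map_comp_left by simp
  have S: "x \<in> dom (S \<circ>\<^sub>m (Some \<circ> H2.pr (orth H2 (range c))))"
    using RCo.pr_in assms(3) unfolding dom_def map_comp_Some_comp by blast
  have XT: "x \<in> dom (X +\<^sub>p ((Some \<circ> H3.pr kerB) \<circ>\<^sub>m T))"
    using x(1) T unfolding dom_op_add by blast
  have "the (((Some \<circ> H3.pr kerB) \<circ>\<^sub>m T) x) = H3.pr kerB (the (T x))"
    unfolding Some_comp_map_comp_left using x(2) by (simp add: option.map_sel domIff)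
  then show ?thesis
    unfolding the_op_add[OF XT S] the_op_add[OF x(1) T] map_comp_Some_comp by simp
qed

text \<open>On the range of \<open>c\<close> the last summand is \<open>S\<close> applied to 0, and
  \<open>b\<close> annihilates the middle one, so \<open>bxc\<close> is unchanged. The rank is
  assumed because \<open>T\<close> and \<open>S\<close> can raise it.\<close>

lemma op_sum_in_S_set:
  assumes X: "X \<in> Ss" and T: "lin_op H2 H3 T" "dom T = domC"
    and S: "lin_op H2 H3 S" "dom S = orth H2 (range c)"
    and r: "dim_at_most H3 (ran (op_sum X T S)) r"
  shows "op_sum X T S \<in> Ss" and "dom (op_sum X T S) = domC"
proof -
  have X': "lin_op H2 H3 X" "domC \<subseteq> dom X" using X unfolding S_set_iff X_set_iff by auto
  show dom: "dom (op_sum X T S) = domC" by (rule dom_op_sum[OF X'(2) T(2) S(2)])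
  have val: "the (op_sum X T S x)
      = the (X x) + H3.pr kerB (the (T x)) + the (S (H2.pr (orth H2 (range c)) x))"
    if "x \<in> domC" for x using the_op_sum[OF X'(2) T(2) S(2) that] .
  have sub: "H2.subspace domC" using T unfolding lin_op_def by simp
  show "op_sum X T S \<in> Ss"
  proof (rule S_set_transfer[OF X _ _ r])
    show "lin_op H2 H3 (op_sum X T S)"
      unfolding lin_op_def dom
    proof (intro conjI ballI allI)
      show "the (op_sum X T S (x + y)) = the (op_sum X T S x) + the (op_sum X T S y)"
        if xy: "x \<in> domC" "y \<in> domC" for x y
      proof -
        have "the (X (x + y)) = the (X x) + the (X y)" "the (T (x + y)) = the (T x) + the (T y)"
          using X' T xy by (auto intro!: lin_op_add)
        moreover have "the (S (H2.pr (orth H2 (range c)) x + H2.pr (orth H2 (range c)) y))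
            = the (S (H2.pr (orth H2 (range c)) x)) + the (S (H2.pr (orth H2 (range c)) y))"
          using S RCo.pr_in by (intro lin_op_add) simp_all
        ultimately show ?thesis
          unfolding val[OF xy(1)] val[OF xy(2)] val[OF H2.subspace_add[OF sub xy]]
            RCo.pr_add by (simp add: KB.pr_add)
      qed
      show "the (op_sum X T S (hscale H2 s x)) = hscale H3 s (the (op_sum X T S x))"
        if x: "x \<in> domC" for s x
      proof -
        have "the (X (hscale H2 s x)) = hscale H3 s (the (X x))"
          "the (T (hscale H2 s x)) = hscale H3 s (the (T x))"
          using X' T x by (auto intro!: lin_op_hscale)
        moreover have "the (S (hscale H2 s (H2.pr (orth H2 (range c)) x)))
            = hscale H3 s (the (S (H2.pr (orth H2 (range c)) x)))"
          using S RCo.pr_in by (intro lin_op_hscale) simp_all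
        ultimately show ?thesis
          unfolding val[OF x] val[OF H2.subspace_scale[OF sub x]] RCo.pr_hscale
          by (simp add: KB.pr_hscale H3.scale_right_distrib)
      qed
    qed (rule sub)
    show "domC \<subseteq> dom (op_sum X T S)" using dom by blast
    show "bxc (op_sum X T S) = bxc X"
    proof
      fix x
      have cx: "c x \<in> domC" using range_c_domC by blast
      have "H2.pr (orth H2 (range c)) (c x) = 0"
        unfolding pr_orth_range_c using range_c_in by simp
      moreover have "b (H3.pr kerB v) = 0" for v using KB.pr_in by blast
      ultimately show "bxc (op_sum X T S) x = bxc X x"
        unfolding bxc_def val[OF cx] by (simp add: blin_add[OF b] H23.lin_op_zero[OF S(1)] blin_zero[OF b])
    qed
  qed
qed

text \<open>With P onto the complement of ker B and Q onto the closure of ran C, write X = P X Q +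
  (1 - P) X + P X (1 - Q). The middle term is the kernel projector applied to X, so T may be X
  itself; S is the restriction of P X to the complement of ran C.\<close>

lemma S_set_decomposition:
  assumes X: "X \<in> Ss" and dom: "dom X = domC"
  obtains X' T S where "X = op_sum X' T S" "X' \<in> Sstar" "lin_op H2 H3 T" "dom T = domC"
    "lin_op H2 H3 S" "dom S = orth H2 (range c)"
proof -
  let ?P = "H3.pr (orth H3 kerB)" and ?Q = "H2.pr ranC"
  have lin: "lin_op H2 H3 X" and r: "dim_at_most H3 (ran X) r"
    using X unfolding S_set_iff X_set_iff by auto
  have sub: "H2.subspace domC" using lin dom unfolding lin_op_def by simp
  have X_add: "the (X (x + y)) = the (X x) + the (X y)" if "x \<in> domC" "y \<in> domC" for x y
    using lin that unfolding lin_op_def dom by blast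
  have X_scale: "the (X (hscale H2 s x)) = hscale H3 s (the (X x))" if "x \<in> domC" for s x
    using lin that unfolding lin_op_def dom by blast
  have Q: "?Q x \<in> domC" if "x \<in> domC" for x using that RC.pr_in by simp
  define X' where "X' x = (if x \<in> domC then Some (?P (the (X (?Q x)))) else None)" for x
  define S where "S x = (if x \<in> orth H2 (range c) then Some (?P (the (X x))) else None)" for x
  have dom': "dom X' = domC" by (auto simp: X'_def dom_def)
  have domS: "dom S = orth H2 (range c)" by (auto simp: S_def dom_def)
  have X': "the (X' x) = ?P (the (X (?Q x)))" if "x \<in> domC" for x using that by (simp add: X'_def)
  have S: "the (S x) = ?P (the (X x))" if "x \<in> orth H2 (range c)" for x using that by (simp add: S_def)
  \<comment> \<open>On the complement of ran C the projection onto the closure of ran C is 0, which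
    is \<open>c 0\<close>; hence \<open>X\<close> is defined there and \<open>S\<close> makes
    sense.\<close>
  have orth_domC: "x \<in> domC" if "x \<in> orth H2 (range c)" for x
    using that RC.pr_of_orth[of x] blin_zero[OF c] rangeI[of c 0] by simp
  have lin': "lin_op H2 H3 X'"
    unfolding lin_op_def dom'
  proof (intro conjI ballI allI)
    show "the (X' (x + y)) = the (X' x) + the (X' y)" if xy: "x \<in> domC" "y \<in> domC" for x y
      unfolding X'[OF xy(1)] X'[OF xy(2)] X'[OF H2.subspace_add[OF sub xy]] RC.pr_add
        X_add[OF Q[OF xy(1)] Q[OF xy(2)]] by (rule KBo.pr_add)
    show "the (X' (hscale H2 s x)) = hscale H3 s (the (X' x))" if x: "x \<in> domC" for s x
      unfolding X'[OF x] X'[OF H2.subspace_scale[OF sub x]] RC.pr_hscale X_scale[OF Q[OF x]]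
      by (rule KBo.pr_hscale)
  qed (rule sub)
  have linS: "lin_op H2 H3 S"
    unfolding lin_op_def domS
  proof (intro conjI ballI allI)
    show "the (S (x + y)) = the (S x) + the (S y)"
      if xy: "x \<in> orth H2 (range c)" "y \<in> orth H2 (range c)" for x y
      unfolding S[OF xy(1)] S[OF xy(2)] S[OF H2.subspace_add[OF RCo.subspace xy]]
        X_add[OF orth_domC[OF xy(1)] orth_domC[OF xy(2)]] by (rule KBo.pr_add)
    show "the (S (hscale H2 s x)) = hscale H3 s (the (S x))" if x: "x \<in> orth H2 (range c)" for s x
      unfolding S[OF x] S[OF H2.subspace_scale[OF RCo.subspace x]] X_scale[OF orth_domC[OF x]]
      by (rule KBo.pr_hscale)
  qed (rule RCo.subspace)
  have "dim_at_most H3 (?P ` ran X) r"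
  proof -
    interpret H33: hilbert_pair H3 H3 ..
    show ?thesis using r
      by (rule H33.dim_at_most_image) (simp_all add: KBo.pr_add KBo.pr_hscale)
  qed
  moreover have "H3.subspace (ran X')"
    unfolding ran_conv_image dom' using sub lin' unfolding lin_op_def dom'
    by (intro H23.subspace_image) auto
  moreover have "ran X' \<subseteq> ?P ` ran X"
  proof -
    have "the (X' x) \<in> ?P ` (\<lambda>x. the (X x)) ` domC" if "x \<in> domC" for x
      unfolding X'[OF that] using Q[OF that] by (intro imageI)
    then show ?thesis unfolding ran_conv_image dom' dom by blast
  qed
  ultimately have r': "dim_at_most H3 (ran X') r" by (rule H3.dim_at_most_mono)
  have "bxc X' = bxc X"
  proof
    fix x
    have cx: "c x \<in> domC" "?Q (c x) = c x" using range_c_domC range_c_in by auto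
    show "bxc X' x = bxc X x"
      unfolding bxc_def X'[OF cx(1)] cx(2) by (rule H34.apply_pr_orth_kernel[OF b])
  qed
  then have X'_Ss: "X' \<in> Ss" using dom' by (intro S_set_transfer[OF X lin' _ r']) auto
  \<comment> \<open>Both projectors are idempotent, so the compressed operator is fixed by a second
    compression.\<close>
  have "X' x = map_option ?P (X' (?Q x))" if "x \<in> domC" for x
    using that Q[OF that] by (simp add: X'_def RC.pr_in KBo.pr_in)
  then have X'_star: "X' \<in> Sstar" using X'_Ss unfolding S_star_set_iff dom' by blast
  have "X = op_sum X' X S"
  proof
    fix x
    show "X x = op_sum X' X S x"
    proof (cases "x \<in> domC")
      case True
      have o: "H2.pr (orth H2 (range c)) x \<in> orth H2 (range c)" by (rule RCo.pr_in)
      \<comment> \<open>Splitting \<open>X x\<close> is legitimate because both components of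
        \<open>x\<close> lie in \<open>domC\<close>.\<close>
      have "x = ?Q x + H2.pr (orth H2 (range c)) x" by (simp add: pr_orth_range_c)
      then have "the (X x) = the (X (?Q x)) + the (X (H2.pr (orth H2 (range c)) x))"
        using X_add[OF Q[OF True] orth_domC[OF o]] by simp
      then have "?P (the (X x)) = the (X' x) + the (S (H2.pr (orth H2 (range c)) x))"
        unfolding X'[OF True] S[OF o] by (simp add: KBo.pr_add)
      moreover have "?P (the (X x)) = the (X x) - H3.pr kerB (the (X x))"
        by (rule KB.pr_orth_complement)
      ultimately have "the (op_sum X' X S x) = the (X x)"
        unfolding the_op_sum[OF equalityD2[OF dom'] dom domS True] by (simp add: algebra_simps)
      moreover have "x \<in> dom (op_sum X' X S)" "x \<in> dom X"
        using dom_op_sum[OF equalityD2[OF dom'] dom domS] True dom by auto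
      ultimately show ?thesis by (intro option.expand) (simp_all only: domIff not_False_eq_True)
    next
      case False
      then have "x \<notin> dom (op_sum X' X S)" "x \<notin> dom X"
        using dom_op_sum[OF equalityD2[OF dom'] dom domS] dom by auto
      then show ?thesis by (metis domIff)
    qed
  qed
  then show thesis using X'_star lin dom linS domS by (rule that)
qed

text \<open>From left to right the rank bound is inherited from admissibility; from right to left it
  is a genuine restriction on the sums.\<close>

theorem S_set_structure:
  "Ss \<inter> {X. dom X = domC} =
   {op_sum X T S | X T S. X \<in> Sstar \<and> lin_op H2 H3 T \<and> dom T = domC \<and>
      lin_op H2 H3 S \<and> dom S = orth H2 (range c)} \<inter> {X. dim_at_most H3 (ran X) r}"
  (is "?L = ?R")
proof
  show "?L \<subseteq> ?R"
  proof
    fix X assume "X \<in> ?L"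
    then have X: "X \<in> Ss" "dom X = domC" by auto
    then have "dim_at_most H3 (ran X) r" unfolding S_set_iff X_set_iff by blast
    moreover obtain X' T S where "X = op_sum X' T S" "X' \<in> Sstar" "lin_op H2 H3 T"
      "dom T = domC" "lin_op H2 H3 S" "dom S = orth H2 (range c)"
      using S_set_decomposition[OF X] .
    ultimately show "X \<in> ?R" by blast
  qed
  show "?R \<subseteq> ?L"
  proof
    fix X assume "X \<in> ?R"
    then obtain X' T S where *: "X = op_sum X' T S" "X' \<in> Sstar" "lin_op H2 H3 T"
      "dom T = domC" "lin_op H2 H3 S" "dom S = orth H2 (range c)" "dim_at_most H3 (ran X) r"
      by blast
    then have "X' \<in> Ss" unfolding S_star_set_iff by blast
    then show "X \<in> ?L" using op_sum_in_S_set[of X' T S] * by simp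
  qed
qed

end

theorem corollary3p9:
  fixes H1 :: "('k::real_or_complex, 'a::banach) hspace"
    and H2 :: "('k, 'b::banach) hspace"
    and H3 :: "('k, 'c::banach) hspace"
    and H4 :: "('k, 'd::banach) hspace"
    and M :: "'a \<rightharpoonup> 'd" and B :: "'c \<rightharpoonup> 'd" and C :: "'a \<rightharpoonup> 'b"
    and r :: nat
  assumes "hilbert_space H1" and "hilbert_space H2" and "hilbert_space H3" and "hilbert_space H4"
    and "separable_space (euclidean :: 'a topology)"
    and "separable_space (euclidean :: 'b topology)"
    and "separable_space (euclidean :: 'c topology)"
    and "separable_space (euclidean :: 'd topology)"
    and "M \<in> hs_ops H1 H4" and "B \<in> bounded_ops H3 H4" and "C \<in> bounded_ops H1 H2"
  shows "(S_set H1 H2 H3 H4 M B C r \<noteq> {} \<longleftrightarrow> Y_set H1 H3 H4 M B C r \<noteq> {}) \<and>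
    (Y_set H1 H3 H4 M B C r \<noteq> {} \<longrightarrow>
      S_set H1 H2 H3 H4 M B C r \<inter> {X. dom X = dom (mp_inverse H1 H2 C)} =
      {X +\<^sub>p (proj H3 (ker B) \<circ>\<^sub>m T) +\<^sub>p (S \<circ>\<^sub>m proj H2 (orth H2 (ran C))) | X T S.
         X \<in> S_star_set H1 H2 H3 H4 M B C r \<and>
         lin_op H2 H3 T \<and> dom T = dom (mp_inverse H1 H2 C) \<and>
         lin_op H2 H3 S \<and> dom S = orth H2 (ran C)}
      \<inter> {X. dim_at_most H3 (ran X) r})"
proof -
  interpret H1: hilbert_space H1 by fact
  interpret H2: hilbert_space H2 by fact
  interpret H3: hilbert_space H3 by fact
  interpret H4: hilbert_space H4 by fact
  interpret H14: hilbert_pair H1 H4 ..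
  interpret H34: hilbert_pair H3 H4 ..
  interpret H12: hilbert_pair H1 H2 ..
  \<comment> \<open>Bounded operators have full domain, so each of the three data is
    \<open>Some\<close> composed with a total function, as the locale expects.\<close>
  obtain m where M: "M = Some \<circ> m" "hs H1 H4 m" using assms(9) H14.hs_ops_iff by blast
  obtain b where B: "B = Some \<circ> b" "blin H3 H4 b" using assms(10) H34.bounded_ops_iff by blast
  obtain c where C: "C = Some \<circ> c" "blin H1 H2 c" using assms(11) H12.bounded_ops_iff by blast
  interpret rank_problem H1 H2 H3 H4 m b c r
    by unfold_locales (use M B C in auto)
  have "ran C = range c" "ker B = {x. b x = 0}"
    unfolding B(1) C(1) by (auto simp: ran_def ker_def)
  then show ?thesis
    using S_set_nonempty_iff S_set_structure
    unfolding M(1) B(1) C(1) dom_mp_inverse_C H2.proj_eq H3.proj_eq by simp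
qed

end
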